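(* Let $\omega_o = 1/\tau_o$. Let $(K^*,1/\omega_o^*,c^* )\in\mathbb{K}$ be a known tuple, with closed-loop state matrix $A_{cl}^* = A_{cl}(K^*,1/\omega_o^*,c^* )$, and let $P^*$ be the known solution of $$A_{cl}^{*T}P^*+P^*A_{cl}^* = -\big(\tilde Q+\tilde C^{*T}R\,\tilde C^*\big),\qquad \tilde C^*=K_d^*N_d^T+K_o^*N_o^T,$$ where $N_d=N_d(c^* )$, $K_d^*=K^*\circ\mathcal I_d$, $K_o^*=K^*\circ\mathcal I_o$. Let $\zeta_1,\zeta_2$ be chosen constants. Let $\omega_o=\omega_o^*+\Delta\omega$ (with $\omega_o>0$), $K=K^*+\Delta K$, $P=P^*+\Delta P$ ($\Delta P$ symmetric) and $\alpha>0$ be obtained as a solution, in the design variables $\alpha,\Delta K,\Delta P,\Delta\omega$, of $$\phi_0+\phi_1+\psi_0+\alpha I\preceq 0,$$ $$|\Delta\omega|\le\zeta_1,\qquad \|\Delta P\|\le\zeta_2,$$ $$\alpha\ \ge\ 2\zeta_1\|\Lambda^T\Delta P\|+2\zeta_2\|\mathcal B\,\Delta\tilde C\|+\|R^{1/2}\Delta\tilde C\|^2,$$ where $\Delta K_d=\Delta K\circ\mathcal I_d$, $\Delta K_o=\Delta K\circ\mathcal I_o$, $\Delta\tilde C=\Delta K_dN_d^T+\Delta K_oN_o^T$, $A_1=-\mathcal B\,\Delta\tilde C+\Delta\omega\,\Lambda$, $\phi_0=A_{cl}^{*T}P+PA_{cl}^*$, $\phi_1=A_1^TP^*+P^*A_1$,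 and $\psi_0=\tilde Q+\tilde C^{*T}R\tilde C^*+\Delta\tilde C^TR\tilde C^*+\tilde C^{*T}R\,\Delta\tilde C$. Then $(K,1/\omega_o,c^* )$ is a stabilizing tuple, i.e. every eigenvalue of $A_{cl}(K,1/\omega_o,c^* )$ has negative real part.
   Context: Setting. $A\in\mathbb R^{n\times n}$, $B\in\mathbb R^{n\times m}$, $Q\in\mathbb R^{n\times n}$ symmetric with $Q\succeq0$, $R\in\mathbb R^{m\times m}$ symmetric with $R\succ0$; $(A,B)$ is stabilizable and $(A,Q^{1/2})$ is detectable. The feedback is $u(t)=-K_dx(t-\tau_d)-K_ox(t-\tau_o)$ with $K\in\mathbb R^{m\times n}$, $K_d=K\circ\mathcal I_d$, $K_o=K\circ\mathcal I_o$ ($\circ$ is the Hadamard product). Here $\mathcal I_d\in\{0,1\}^{m\times n}$ is defined from partitions $\{\mathfrak u_q\}_{q=1}^{\mathcal N}$ of $\{1,\dots,m\}$ and $\{\mathfrak x_q\}_{q=1}^{\mathcal N}$ of $\{1,\dots,n\}$ into nonempty sets by $\mathcal I_d(i,j)=1$ iff $i\in\mathfrak u_q$ and $j\in\mathfrak x_q$ for some $q$, and $\mathcal I_o$ is the complement of $\mathcal I_d$ (all-ones matrix minus $\mathcal I_d$). The delays are $\tau_o>0$ and $\tau_d$, with ratio $c=\tau_d/\tau_o\in[0,1]$. Discretization. Fix an integer $N\ge2$ and the grid $\theta_{k+1}=\frac{\tau_o}{2}\big(\cos\frac{(N-k-1)\pi}{N-1}-1\big)$, $k=0,\dots,N-1$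 (so $\theta_1=-\tau_o$, $\theta_N=0$), with Lagrange polynomials $l_j(\theta)=\prod_{m\ne j}\frac{\theta-\theta_m}{\theta_j-\theta_m}$. Define the $Nn\times n$ block matrices $M=[0,\dots,0,I_n]^T$, $N_o=[I_n,0,\dots,0]^T$, $N_d(c)=[l_1(-c\tau_o),\dots,l_N(-c\tau_o)]^T\otimes I_n$ (this depends only on $c$), and $\mathcal B=MB$, $\tilde Q=MQM^T$. Let $\Lambda\in\mathbb R^{Nn\times Nn}$ be the block matrix with $(i,j)$ block $\tau_o\,l_j'(\theta_i)I_n$ for $i\le N-1$ and zero last block row (it does not depend on $\tau_o$), and $\tilde A=\frac1{\tau_o}\Lambda+\mathrm{Diag}(0,A)$, where $\mathrm{Diag}(0,A)$ has $A$ as its last $n\times n$ diagonal block and zeros elsewhere. The closed-loop state matrix of the discretized delayed system is $$A_{cl}(K,\tau_o,c)=\tilde A-\mathcal B K_oN_o^T-\mathcal B K_dN_d(c)^T .$$ $\mathbb K$ is the set of tuples $(K,\tau_o,c)$ for which all eigenvalues of $A_{cl}(K,\tau_o,c)$ have negative real part (stabilizing tuples). $\|\cdot\|$ is the spectral norm; $\preceq$ is the order on symmetric matrices. *)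

theory Defs
  imports "HOL-Analysis.Analysis"
begin

definition hadamard :: "real^'n^'m \<Rightarrow> real^'n^'m \<Rightarrow> real^'n^'m"  (infixl "\<circ>\<^sub>H" 75) where
  "X \<circ>\<^sub>H Y = (\<chi> i j. X $ i $ j * Y $ i $ j)"

definition spec_norm :: "real^'n^'m \<Rightarrow> real" where
  "spec_norm X = onorm (\<lambda>x. X *v x)"

definition loewner_le :: "real^'n^'n \<Rightarrow> real^'n^'n \<Rightarrow> bool"  (infix "\<preceq>\<^sub>L" 50) where
  "X \<preceq>\<^sub>L Y \<longleftrightarrow> transpose X = X \<and> transpose Y = Y \<and> (\<forall>x. 0 \<le> x \<bullet> ((Y - X) *v x))"

definition loewner_less :: "real^'n^'n \<Rightarrow> real^'n^'n \<Rightarrow> bool"  (infix "\<prec>\<^sub>L" 50) where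
  "X \<prec>\<^sub>L Y \<longleftrightarrow> transpose X = X \<and> transpose Y = Y \<and> (\<forall>x. x \<noteq> 0 \<longrightarrow> 0 < x \<bullet> ((Y - X) *v x))"

text \<open>Well defined only for \<open>0 \<preceq>\<^sub>L X\<close>, where the root exists and is unique.\<close>

definition psd_sqrt :: "real^'n^'n \<Rightarrow> real^'n^'n" where
  "psd_sqrt X = (THE S. 0 \<preceq>\<^sub>L S \<and> S ** S = X)"

definition eigenvalues :: "real^'n^'n \<Rightarrow> complex set" where
  "eigenvalues X = {z. \<exists>v. v \<noteq> 0 \<and> map_matrix complex_of_real X *v v = z *s v}"

definition hurwitz :: "real^'n^'n \<Rightarrow> bool" where
  "hurwitz X \<longleftrightarrow> (\<forall>z\<in>eigenvalues X. Re z < 0)"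

definition stabilizable :: "real^'n^'n \<Rightarrow> real^'m^'n \<Rightarrow> bool" where
  "stabilizable A B \<longleftrightarrow> (\<exists>F::real^'n^'m. hurwitz (A - B ** F))"

definition detectable :: "real^'n^'n \<Rightarrow> real^'n^'p \<Rightarrow> bool" where
  "detectable A C \<longleftrightarrow> (\<exists>L::real^'p^'n. hurwitz (A - L ** C))"

definition indexed_partition :: "nat \<Rightarrow> (nat \<Rightarrow> 'a set) \<Rightarrow> bool" where
  "indexed_partition k U \<longleftrightarrow>
     (\<forall>q\<in>{1..k}. U q \<noteq> {}) \<and> disjoint_family_on U {1..k} \<and> (\<Union>q\<in>{1..k}. U q) = UNIV"

definition pattern_d :: "nat \<Rightarrow> (nat \<Rightarrow> 'm set) \<Rightarrow> (nat \<Rightarrow> 'n set) \<Rightarrow> real^'n^'m" where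
  "pattern_d k U X = (\<chi> i j. if \<exists>q\<in>{1..k}. i \<in> U q \<and> j \<in> X q then 1 else 0)"

definition pattern_o :: "real^'n^'m \<Rightarrow> real^'n^'m" where
  "pattern_o Id_pat = (\<chi> i j. 1 - Id_pat $ i $ j)"

text \<open>
  The grid is indexed by a finite linearly ordered type with \<open>CARD('g)\<close> playing the role of the
  number \<open>N\<close> of nodes. A vector of length \<open>N n\<close> is indexed by \<open>'g \<times> 'n\<close>: its first index
  selects the block, the second the entry within it. Nodes are numbered from 1 by \<open>pos\<close>.
\<close>

definition pos :: "'g::{finite,linorder} \<Rightarrow> nat" where
  "pos i = card {j. j \<le> i}"

lemma strict_mono_pos: "strict_mono (pos :: 'g::{finite,linorder} \<Rightarrow> nat)"
  unfolding strict_mono_def pos_def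
proof (intro allI impI psubset_card_mono)
  fix x y :: 'g
  assume "x < y"
  then show "{j. j \<le> x} \<subset> {j. j \<le> y}"
    by (intro psubsetI subsetI) (auto dest: order.strict_trans1 simp: set_eq_iff not_le)
qed simp

lemma bij_betw_pos: "bij_betw pos (UNIV :: 'g::{finite,linorder} set) {1..CARD('g)}"
proof -
  have inj: "inj (pos :: 'g \<Rightarrow> nat)"
    using strict_mono_pos strict_mono_imp_inj_on by blast
  have "pos i \<in> {1..CARD('g)}" for i :: 'g
  proof -
    have "card {j. j \<le> i} > 0"
      by (subst card_gt_0_iff) auto
    moreover have "card {j. j \<le> i} \<le> CARD('g)"
      by (rule card_mono) auto
    ultimately show ?thesis by (simp add: pos_def)
  qed
  then have "range (pos :: 'g \<Rightarrow> nat) \<subseteq> {1..CARD('g)}" by blast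
  moreover have "card (range (pos :: 'g \<Rightarrow> nat)) = card {1..CARD('g)}"
    using card_image[OF inj] by (simp only: card_atLeastAtMost diff_Suc_1)
  ultimately have "range (pos :: 'g \<Rightarrow> nat) = {1..CARD('g)}"
    by (intro card_subset_eq finite_atLeastAtMost)
  with inj show ?thesis
    unfolding bij_betw_def by (rule conjI)
qed

definition grid :: "real \<Rightarrow> 'g::{finite,linorder} \<Rightarrow> real" where
  "grid \<tau> i = \<tau> / 2 * (cos ((real CARD('g) - real (pos i)) * pi / (real CARD('g) - 1)) - 1)"

definition lagrange :: "real \<Rightarrow> 'g::{finite,linorder} \<Rightarrow> real \<Rightarrow> real" where
  "lagrange \<tau> j \<theta> = (\<Prod>m\<in>UNIV - {j}. (\<theta> - grid \<tau> m) / (grid \<tau> j - grid \<tau> m))"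

definition M_mat :: "real^'n^('g::{finite,linorder} \<times> 'n::finite)" where
  "M_mat = (\<chi> p b. if pos (fst p) = CARD('g) \<and> snd p = b then 1 else 0)"

definition No_mat :: "real^'n^('g::{finite,linorder} \<times> 'n::finite)" where
  "No_mat = (\<chi> p b. if pos (fst p) = 1 \<and> snd p = b then 1 else 0)"

definition Nd_mat :: "real \<Rightarrow> real \<Rightarrow> real^'n^('g::{finite,linorder} \<times> 'n::finite)" where
  "Nd_mat \<tau> c = (\<chi> p b. if snd p = b then lagrange \<tau> (fst p) (- c * \<tau>) else 0)"

definition Lambda_mat :: "real \<Rightarrow> real^('g::{finite,linorder} \<times> 'n::finite)^('g \<times> 'n)" where
  "Lambda_mat \<tau> = (\<chi> p q. if pos (fst p) < CARD('g) \<and> snd p = snd q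
     then \<tau> * deriv (lagrange \<tau> (fst q)) (grid \<tau> (fst p)) else 0)"

definition last_block :: "real^'n^'n \<Rightarrow> real^('g::{finite,linorder} \<times> 'n::finite)^('g \<times> 'n)" where
  "last_block A = (\<chi> p q. if pos (fst p) = CARD('g) \<and> pos (fst q) = CARD('g)
     then A $ snd p $ snd q else 0)"

text \<open>\<open>Nd_mat\<close> and \<open>Lambda_mat\<close> carry the delay as an argument but do not depend on it.\<close>

lemma grid_scale: "grid \<tau> i = \<tau> * grid 1 i"
  unfolding grid_def by (simp only: times_divide_eq_left times_divide_eq_right mult_1 mult_1_right)

lemma lagrange_scale:
  fixes j :: "'g::{finite,linorder}"
  assumes "\<tau> \<noteq> 0"
  shows "lagrange \<tau> j \<theta> = lagrange 1 j (\<theta> / \<tau>)"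
proof -
  have "(\<theta> - grid \<tau> m) / (grid \<tau> j - grid \<tau> m)
      = (\<theta> / \<tau> - grid 1 m) / (grid 1 j - grid 1 m)" for m :: 'g
  proof -
    have "\<theta> - grid \<tau> m = \<tau> * (\<theta> / \<tau> - grid 1 m)"
      using assms by (simp add: grid_scale[of \<tau>] right_diff_distrib)
    moreover have "grid \<tau> j - grid \<tau> m = \<tau> * (grid 1 j - grid 1 m)"
      by (simp add: grid_scale[of \<tau>] right_diff_distrib)
    ultimately show ?thesis using assms by simp
  qed
  then show ?thesis by (simp add: lagrange_def)
qed

lemma lagrange_differentiable:
  fixes j :: "'g::{finite,linorder}"
  shows "lagrange \<tau> j field_differentiable at \<theta>"
proof -
  have "(\<lambda>\<theta>. \<Prod>m\<in>S. (\<theta> - grid \<tau> m) / (grid \<tau> j - grid \<tau> m))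
      field_differentiable at \<theta>" if "finite S" for S :: "'g set"
    using that
  proof (induction S rule: finite_induct)
    case (insert m S)
    have "(\<lambda>\<theta>. (\<theta> - grid \<tau> m) / (grid \<tau> j - grid \<tau> m)) field_differentiable at \<theta>"
      unfolding divide_inverse
      by (intro field_differentiable_mult field_differentiable_diff
          field_differentiable_ident field_differentiable_const)
    from field_differentiable_mult[OF this insert.IH] show ?case
      using insert.hyps by simp
  qed simp
  from this[of "UNIV - {j}"] show ?thesis
    unfolding lagrange_def[abs_def] by simp
qed

lemma Nd_mat_indep: "\<tau> \<noteq> 0 \<Longrightarrow> Nd_mat \<tau> c = Nd_mat 1 c"
  by (simp add: Nd_mat_def lagrange_scale[of \<tau>] vec_eq_iff)

lemma Lambda_mat_indep:
  assumes "\<tau> \<noteq> 0"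
  shows "(Lambda_mat \<tau> :: real^('g::{finite,linorder} \<times> 'n::finite)^('g \<times> 'n)) = Lambda_mat 1"
proof -
  have "\<tau> * deriv (lagrange \<tau> j) (grid \<tau> i) = deriv (lagrange 1 j) (grid 1 i)" for i j :: 'g
  proof -
    have eq: "lagrange \<tau> j = lagrange 1 j \<circ> (\<lambda>\<theta>. \<theta> / \<tau>)"
      using lagrange_scale[OF assms, of j] by (simp add: fun_eq_iff)
    have "((\<lambda>\<theta>. \<theta> / \<tau>) has_field_derivative 1 / \<tau>) (at (grid \<tau> i))"
      using assms by (auto intro!: derivative_eq_intros)
    moreover have "(lagrange 1 j has_field_derivative deriv (lagrange 1 j) (grid 1 i))
        (at (grid \<tau> i / \<tau>))"
      using lagrange_differentiable[of 1 j] assms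
      by (simp add: field_differentiable_derivI grid_scale[of \<tau>])
    ultimately have "deriv (lagrange \<tau> j) (grid \<tau> i) = deriv (lagrange 1 j) (grid 1 i) * (1 / \<tau>)"
      unfolding eq by (intro DERIV_imp_deriv DERIV_chain)
    then show ?thesis using assms by simp
  qed
  then show ?thesis by (simp add: Lambda_mat_def vec_eq_iff)
qed

definition A_tilde :: "real^'n^'n \<Rightarrow> real \<Rightarrow> real^('g::{finite,linorder} \<times> 'n::finite)^('g \<times> 'n)" where
  "A_tilde A \<tau> = (1 / \<tau>) *\<^sub>R Lambda_mat \<tau> + last_block A"

definition B_cal :: "real^'m^'n \<Rightarrow> real^'m^('g::{finite,linorder} \<times> 'n::finite)" where
  "B_cal B = M_mat ** B"

definition Q_tilde :: "real^'n^'n \<Rightarrow> real^('g::{finite,linorder} \<times> 'n::finite)^('g \<times> 'n)" where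
  "Q_tilde Q = M_mat ** Q ** transpose M_mat"

definition A_cl :: "real^'n^'n \<Rightarrow> real^'m^'n \<Rightarrow> real^'n^'m \<Rightarrow> real^'n^'m \<Rightarrow> real \<Rightarrow> real
    \<Rightarrow> real^('g::{finite,linorder} \<times> 'n::finite)^('g \<times> 'n)" where
  "A_cl A B Id_pat K \<tau> c = A_tilde A \<tau>
     - B_cal B ** (K \<circ>\<^sub>H pattern_o Id_pat) ** transpose No_mat
     - B_cal B ** (K \<circ>\<^sub>H Id_pat) ** transpose (Nd_mat \<tau> c)"

text \<open>The argument of type \<open>'g itself\<close> fixes the grid, which the tuples do not mention.\<close>

definition stabilizing_tuples :: "'g::{finite,linorder} itself \<Rightarrow> real^'n^'n \<Rightarrow> real^'m^'n
    \<Rightarrow> real^'n^'m \<Rightarrow> ((real^'n^'m) \<times> real \<times> real) set" where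
  "stabilizing_tuples _ A B Id_pat = {(K, \<tau>, c). 0 < \<tau> \<and> 0 \<le> c \<and> c \<le> 1 \<and>
     hurwitz (A_cl A B Id_pat K \<tau> c :: real^('g \<times> 'n)^('g \<times> 'n))}"

end

theory Submission
  imports Defs "HOL-Complex_Analysis.Great_Picard"
begin

text \<open>
  The matrix inequality and the bounds on \<open>\<alpha>\<close> yield only
  \<open>A\<^sub>c\<^sub>l\<^sup>T P + P A\<^sub>c\<^sub>l \<preceq> - (Q + C\<^sup>T R C)\<close> for the new tuple (writing \<open>Q\<close> and \<open>C\<close> for the extended
  matrices), where the right-hand side may be singular and nothing is known about the sign of \<open>P\<close>. So \<open>P\<close>
  cannot serve as a Lyapunov function at once, and stability is obtained by deformation from the
  known tuple.

  Since the closed-loop matrix is affine in the gain and in \<open>\<omega>\<^sub>o\<close>, the segment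
  \<open>A\<^sub>t = A\<^sub>c\<^sub>l\<^sup>* + t (\<Delta>\<omega> \<Lambda> - B \<Delta>C)\<close>, \<open>P\<^sub>t = P\<^sup>* + t \<Delta>P\<close>, \<open>C\<^sub>t = C\<^sup>* + t \<Delta>C\<close> ends in the new tuple. Along it
  the quadratic form of \<open>A\<^sub>t\<^sup>T P\<^sub>t + P\<^sub>t A\<^sub>t + Q + C\<^sub>t\<^sup>T R C\<^sub>t\<close> is at most \<open>- t (1 - t) \<alpha> |x|\<^sup>2\<close>
  (\<open>dissipation_along_homotopy\<close>): the Lyapunov equation removes the constant term, the matrix inequality
  bounds the linear term and the norm bounds control the quadratic one. On an eigenvector with imaginary
  eigenvalue the first two terms of the form cancel while the others are nonnegative, so for
  \<open>0 < t < 1\<close> no eigenvalue lies on the imaginary axis. As \<open>A\<^sub>0\<close> is Hurwitz and eigenvalues move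
  continuously, no eigenvalue at the end of the segment has positive real part
  (\<open>hurwitz_homotopy\<close>).

  At \<open>t = 1\<close> an imaginary eigenvector must have zero cost, hence it feels no feedback and is not seen
  by \<open>Q\<close>. Detectability makes its last block zero (\<open>uncontrolled_imaginary_mode_vanishes\<close>), and it
  becomes an eigenvector of the spectral differentiation matrix with zero boundary value. The core
  of the proof is that Chebyshev collocation of \<open>p' = z p\<close>, \<open>p 1 = 0\<close> has no imaginary eigenvalue
  (\<open>chebyshev_collocation_no_imaginary_eigenvalue\<close>). This follows from an energy balance and a
  conserved Wronskian of the recurrence for the Chebyshev coefficients of \<open>p\<close>.
\<close>

section \<open>An energy identity for Chebyshev coefficients\<close>

lemma Re_mult_cnj_imaginary:
  fixes z u v :: complex
  assumes "Re z = 0"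
  shows "Re (z * u * cnj v) = - Re (z * v * cnj u)"
  using assms by (simp add: algebra_simps)

lemma Re_divide_imaginary:
  fixes z u :: complex
  assumes "Re z = 0"
  shows "Re (of_real r / z * u * cnj u) = 0"
proof -
  have "of_real r / z * u * cnj u = of_real (r * (cmod u)\<^sup>2) / z"
    by (simp only: of_real_mult complex_norm_square times_divide_eq_left mult.assoc)
  then show ?thesis using assms by (simp only: Re_divide) simp
qed

text \<open>
  Here \<open>b\<close> stands for the Chebyshev coefficients of a polynomial \<open>p\<close> (the zeroth one doubled) and \<open>c\<close>
  for their partial sums, which are the coefficients of \<open>p\<close> with respect to \<open>T\<^sub>k - T\<^sub>k\<^sub>+\<^sub>1\<close>; the recurrence
  expresses \<open>p' - z p\<close> in Chebyshev polynomials of the second kind. Multiplying it by the conjugate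
  of \<open>s (Suc k)\<close> and taking real parts is a discrete integration by parts: the difference
  \<open>b k - b (k + 2)\<close> equals \<open>2 s (k + 1) - s (k + 2) - s k\<close>, whose contribution telescopes because
  multiplication by an imaginary \<open>z\<close> is skew.
\<close>

lemma energy_balance:
  fixes b c e s :: "nat \<Rightarrow> complex"
  assumes z: "Re z = 0"
    and b0: "b 0 = 2 * c 0" and bS: "\<And>k. b (Suc k) = c (Suc k) - c k"
    and s0: "s 0 = 0" and sS: "\<And>k. s (Suc k) = c k + c (Suc k)"
    and rec: "\<And>k. of_nat (Suc k) * b (Suc k) - z / 2 * (b k - b (Suc (Suc k))) = e (Suc k)"
  shows "(\<Sum>k<j. (cmod (c k))\<^sup>2) = j * (cmod (c j))\<^sup>2 + Re (z * s (Suc j) * cnj (s j)) / 2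
           - (\<Sum>k=1..j. Re (e k * cnj (s k)))"
proof (induction j)
  case 0
  show ?case by (simp add: s0)
next
  case (Suc j)
  have bdiff: "b j - b (Suc (Suc j)) = 2 * s (Suc j) - s (Suc (Suc j)) - s j"
    by (cases j) (simp_all add: b0 bS s0 sS)
  have "Re (e (Suc j) * cnj (s (Suc j)))
      = Re (of_nat (Suc j) * b (Suc j) * cnj (s (Suc j)))
        - Re (z * (2 * s (Suc j) - s (Suc (Suc j)) - s j) * cnj (s (Suc j))) / 2"
  proof -
    have "e (Suc j) * cnj (s (Suc j)) = of_nat (Suc j) * b (Suc j) * cnj (s (Suc j))
        - z * (2 * s (Suc j) - s (Suc (Suc j)) - s j) * cnj (s (Suc j)) / 2"
      unfolding rec[symmetric] bdiff by (simp only: left_diff_distrib times_divide_eq_left)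
    then show ?thesis by (simp only: minus_complex.sel Re_divide_numeral)
  qed
  also have "Re (of_nat (Suc j) * b (Suc j) * cnj (s (Suc j)))
      = Suc j * ((cmod (c (Suc j)))\<^sup>2 - (cmod (c j))\<^sup>2)"
    unfolding cmod_power2 bS sS by (simp add: algebra_simps power2_eq_square)
  also have "Re (z * (2 * s (Suc j) - s (Suc (Suc j)) - s j) * cnj (s (Suc j)))
      = 2 * Re (z * s (Suc j) * cnj (s (Suc j))) - Re (z * s (Suc (Suc j)) * cnj (s (Suc j)))
        - Re (z * s j * cnj (s (Suc j)))"
    by (simp add: algebra_simps)
  also have "Re (z * s (Suc j) * cnj (s (Suc j))) = 0"
    using Re_mult_cnj_imaginary[OF z, of "s (Suc j)" "s (Suc j)"] by linarith
  also have "Re (z * s j * cnj (s (Suc j))) = - Re (z * s (Suc j) * cnj (s j))"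
    by (rule Re_mult_cnj_imaginary[OF z])
  finally have "Re (e (Suc j) * cnj (s (Suc j)))
      = real (Suc j) * (cmod (c (Suc j)))\<^sup>2 - real j * (cmod (c j))\<^sup>2 - (cmod (c j))\<^sup>2
        + Re (z * s (Suc (Suc j)) * cnj (s (Suc j))) / 2 - Re (z * s (Suc j) * cnj (s j)) / 2"
    by (simp add: algebra_simps diff_divide_distrib del: times_complex.sel)
  moreover have "(\<Sum>k=1..Suc j. Re (e k * cnj (s k)))
      = (\<Sum>k=1..j. Re (e k * cnj (s k))) + Re (e (Suc j) * cnj (s (Suc j)))"
    by simp
  ultimately show ?case
    using Suc.IH unfolding sum.lessThan_Suc by linarith
qed

text \<open>
  With \<open>n = m + 2\<close>, the hypotheses say that \<open>p' - z p\<close> is a multiple of \<open>(1 + x) U\<^sub>n\<^sub>-\<^sub>1\<close> and that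
  \<open>p 1 = 0\<close>. Three facts contradict each other unless \<open>b n\<close> is zero. The energy balance gives
  \<open>\<Sum>k<n. |c k|\<^sup>2 = n |b n|\<^sup>2\<close>. Multiplying the recurrence by the conjugate of \<open>b (k + 1)\<close> shows that
  the real part of \<open>b k\<close> times the conjugate of \<open>b (k + 1)\<close> does not depend on \<open>k\<close>; its value
  \<open>4 |b n|\<^sup>2\<close> bounds \<open>|b k|\<^sup>2 + |b (k + 1)|\<^sup>2\<close> from below. Finally
  \<open>|b (k + 1)|\<^sup>2 \<le> 2 |c k|\<^sup>2 + 2 |c (k + 1)|\<^sup>2\<close> turns the energy into an upper bound on the sum of the
  \<open>|b k|\<^sup>2\<close>. The two bounds on that sum agree exactly, up to a positive multiple of \<open>|b n / z|\<^sup>2\<close>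
  by which the lower one is larger.
\<close>

lemma leading_coefficient_vanishes:
  fixes b c :: "nat \<Rightarrow> complex"
  assumes z: "Re z = 0" "z \<noteq> 0"
    and b0: "b 0 = 2 * c 0" and bS: "\<And>k. b (Suc k) = c (Suc k) - c k"
    and c_end: "\<And>k. k \<ge> m + 2 \<Longrightarrow> c k = 0"
    and rec: "\<And>k. k < m \<Longrightarrow> of_nat (Suc k) * b (Suc k) - z / 2 * (b k - b (Suc (Suc k))) = 0"
    and rec1: "of_nat (m + 1) * b (m + 1) - z / 2 * (b m - b (m + 2)) = - (z / 2 * b (m + 2))"
    and rec2: "of_nat (m + 2) * b (m + 2) - z / 2 * (b (m + 1) - b (m + 3)) = - (z * b (m + 2))"
  shows "b (m + 2) = 0"
proof -
  define \<beta> where "\<beta> = b (m + 2)"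
  define N where "N = (cmod \<beta>)\<^sup>2"
  define q where "q = (\<lambda>r. of_real r / z)"
  have q: "Re (q r * u * cnj u) = 0" for r u
    unfolding q_def by (rule Re_divide_imaginary[OF z(1)])
  define \<gamma> where "\<gamma> = (\<lambda>k. (cmod (c k))\<^sup>2)"
  have solve: "u = w + q (2 * real j) * v"
    if "of_nat j * v - z / 2 * (u - w) = 0" for u v w and j :: nat
    using that z by (simp add: q_def field_simps)
  have b3: "b (m + 3) = 0"
    using c_end[of "m + 3"] c_end[of "m + 2"] bS[of "m + 2"] by (simp add: eval_nat_numeral)
  have b1: "b (m + 1) = 2 * \<beta> + q (2 * real (m + 2)) * \<beta>"
    using rec2 b3 z by (simp add: \<beta>_def q_def field_simps)
  have b_m: "b m = 2 * \<beta> + q (2 * real (m + 1)) * b (m + 1)"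
    using rec1 z by (simp add: \<beta>_def q_def field_simps)
  have c1: "c (m + 1) = - \<beta>"
    using c_end[of "m + 2"] bS[of "m + 1"] by (simp add: \<beta>_def)
  have cm: "c m = - \<beta> - b (m + 1)"
    using bS[of m] c1 by (simp add: algebra_simps)

  have Re_b1: "Re (\<beta> * cnj (b (m + 1))) = 2 * N"
  proof -
    have "Re (\<beta> * cnj (b (m + 1))) = Re (b (m + 1) * cnj \<beta>)"
      by simp
    also have "\<dots> = 2 * N + Re (q (2 * real (m + 2)) * \<beta> * cnj \<beta>)"
      unfolding b1 N_def cmod_power2
      by (simp only: distrib_right plus_complex.sel) (simp add: power2_eq_square)
    finally show ?thesis by (simp only: q add_0_right)
  qed
  \<comment> \<open>A discrete Wronskian: conserved when the index decreases, starting from its value at the top.\<close>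
  have wronskian: "Re (b (m - i) * cnj (b (Suc (m - i)))) = 4 * N" if "i \<le> m" for i
    using that
  proof (induction i)
    case 0
    have "Re (b m * cnj (b (m + 1)))
        = 2 * Re (\<beta> * cnj (b (m + 1))) + Re (q (2 * real (m + 1)) * b (m + 1) * cnj (b (m + 1)))"
      by (subst b_m) (simp only: distrib_right plus_complex.sel, simp)
    then show ?case using Re_b1 by (simp add: q del: times_complex.sel)
  next
    case (Suc i)
    define k where "k = m - Suc i"
    have k: "k < m" "Suc k = m - i" using Suc.prems by (auto simp: k_def)
    have "b k = b (Suc (Suc k)) + q (2 * real (Suc k)) * b (Suc k)"
      by (rule solve) (rule rec[OF k(1)])
    then have "Re (b k * cnj (b (Suc k))) = Re (b (Suc (Suc k)) * cnj (b (Suc k)))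
        + Re (q (2 * real (Suc k)) * b (Suc k) * cnj (b (Suc k)))"
      by (simp only: distrib_right plus_complex.sel)
    also have "\<dots> = Re (b (Suc k) * cnj (b (Suc (Suc k))))"
      by (simp only: q) simp
    also have "\<dots> = 4 * N"
      using Suc.IH Suc.prems unfolding k(2)[symmetric] by simp
    finally show ?case unfolding k_def .
  qed
  have pair: "8 * N \<le> (cmod (b k))\<^sup>2 + (cmod (b (Suc k)))\<^sup>2" if "k \<le> m" for k
  proof -
    have "Re (b k * cnj (b (Suc k))) = 4 * N"
      using wronskian[of "m - k"] that by simp
    moreover have "2 * Re (b k * cnj (b (Suc k))) \<le> (cmod (b k))\<^sup>2 + (cmod (b (Suc k)))\<^sup>2"
    proof -
      have "0 \<le> (cmod (b k - b (Suc k)))\<^sup>2" by simp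
      also have "\<dots> = (cmod (b k))\<^sup>2 + (cmod (b (Suc k)))\<^sup>2 - 2 * Re (b k * cnj (b (Suc k)))"
        unfolding cmod_power2 by (simp add: power2_eq_square algebra_simps)
      finally show ?thesis by simp
    qed
    ultimately show ?thesis by simp
  qed
  have lower: "4 * real j * N + (cmod (b 1))\<^sup>2 / 2 + (cmod (b (Suc j)))\<^sup>2 / 2
      \<le> (\<Sum>k\<le>j. (cmod (b (Suc k)))\<^sup>2)" if "j \<le> m" for j
    using that
  proof (induction j)
    case (Suc j)
    then show ?case using pair[of "Suc j"] by (simp add: algebra_simps)
  qed simp

  \<comment> \<open>The balance is evaluated at \<open>m + 2\<close>, where the boundary terms vanish; only two residual coefficients can be nonzero up to there.\<close>
  have total: "(\<Sum>k<m + 2. \<gamma> k) = (m + 2) * N"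
  proof -
    define s where "s = (\<lambda>k. case k of 0 \<Rightarrow> 0 | Suc k \<Rightarrow> c k + c (Suc k))"
    define e where "e = (\<lambda>k. of_nat k * b k - z / 2 * (b (k - 1) - b (Suc k)))"
    define t where "t = 4 * \<beta> + q (2 * real (m + 2)) * \<beta>"
    have index: "m + 1 - 1 = m" "Suc (m + 1) = m + 2" "m + 2 - 1 = m + 1" "Suc (m + 2) = m + 3"
      by simp_all
    have "(\<Sum>k<m + 2. \<gamma> k) = (m + 2) * (cmod (c (m + 2)))\<^sup>2
        + Re (z * s (Suc (m + 2)) * cnj (s (m + 2))) / 2 - (\<Sum>k=1..m + 2. Re (e k * cnj (s k)))"
      unfolding \<gamma>_def
      by (rule energy_balance[where b = b]) (use z b0 bS in \<open>simp_all add: s_def e_def\<close>)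
    also have "s (Suc (m + 2)) = 0" by (simp add: s_def c_end)
    also have "c (m + 2) = 0" by (simp add: c_end)
    also have "(\<Sum>k=1..m + 2. Re (e k * cnj (s k)))
        = (\<Sum>k=1..m. Re (e k * cnj (s k))) + Re (e (m + 1) * cnj (s (m + 1))) + Re (e (m + 2) * cnj (s (m + 2)))"
      by simp
    also have "(\<Sum>k=1..m. Re (e k * cnj (s k))) = 0"
    proof (rule sum.neutral, intro ballI)
      fix k assume k: "k \<in> {1..m}"
      then obtain i where "k = Suc i" "i < m" by (cases k) auto
      then have "e k = 0" unfolding e_def using rec by (simp only: diff_Suc_1)
      then show "Re (e k * cnj (s k)) = 0" by simp
    qed
    also have "e (m + 1) = - (z / 2 * \<beta>)" by (simp only: e_def \<beta>_def index rec1)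
    also have "e (m + 2) = - (z * \<beta>)" by (simp only: e_def \<beta>_def index rec2)
    also have "s (m + 1) = - t"
    proof -
      have "s (m + 1) = c m + c (m + 1)" by (simp add: s_def)
      then show ?thesis unfolding cm c1 b1 t_def by simp
    qed
    also have "s (m + 2) = - \<beta>" using c1 c_end[of "m + 2"] by (simp add: s_def)
    finally have sum: "(\<Sum>k<m + 2. \<gamma> k) = - (Re (z / 2 * \<beta> * cnj t) + Re (z * \<beta> * cnj \<beta>))"
      by (simp del: times_complex.sel)
    have "z / cnj z = -1"
    proof -
      have "cnj z = - z" using z(1) by (simp add: complex_eq_iff)
      then show ?thesis using z by simp
    qed
    moreover have "z / 2 * \<beta> * cnj t
        = 2 * (z * \<beta> * cnj \<beta>) + of_real (real (m + 2)) * (z / cnj z) * (\<beta> * cnj \<beta>)"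
      by (simp add: t_def q_def algebra_simps add_divide_distrib)
    moreover have "\<beta> * cnj \<beta> = of_real N"
      by (simp only: N_def complex_norm_square)
    ultimately have "z / 2 * \<beta> * cnj t = 2 * (z * \<beta> * cnj \<beta>) - of_real (real (m + 2) * N)"
      by (simp only: of_real_mult mult_minus1_right mult_minus_left diff_conv_add_uminus)
    then have "Re (z / 2 * \<beta> * cnj t) = 2 * Re (z * \<beta> * cnj \<beta>) - real (m + 2) * N"
      by (simp only: minus_complex.sel mult_2 plus_complex.sel Re_complex_of_real)
    moreover have "Re (z * \<beta> * cnj \<beta>) = 0"
      using Re_mult_cnj_imaginary[OF z(1), of \<beta> \<beta>] by linarith
    ultimately show ?thesis using sum by linarith
  qed
  have upper: "(\<Sum>k\<le>m. (cmod (b (Suc k)))\<^sup>2) \<le> (4 * m + 6) * N - 2 * \<gamma> 0"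
  proof -
    have "(cmod (b (Suc k)))\<^sup>2 \<le> 2 * \<gamma> k + 2 * \<gamma> (Suc k)" for k
    proof -
      have "(cmod (b (Suc k)))\<^sup>2 + (cmod (c (Suc k) + c k))\<^sup>2 = 2 * \<gamma> k + 2 * \<gamma> (Suc k)"
        unfolding bS \<gamma>_def cmod_power2 by (simp add: power2_eq_square algebra_simps)
      then show ?thesis using zero_le_power2[of "cmod (c (Suc k) + c k)"] by linarith
    qed
    then have "(\<Sum>k\<le>m. (cmod (b (Suc k)))\<^sup>2) \<le> (\<Sum>k\<le>m. 2 * \<gamma> k + 2 * \<gamma> (Suc k))"
      by (intro sum_mono)
    also have "\<dots> = 2 * (\<Sum>k\<le>m. \<gamma> k) + 2 * (\<Sum>k\<le>m. \<gamma> (Suc k))"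
      by (simp add: sum.distrib sum_distrib_left)
    also have "(\<Sum>k\<le>m. \<gamma> k) = (\<Sum>k<m + 2. \<gamma> k) - \<gamma> (m + 1)"
      by (simp add: lessThan_Suc_atMost)
    also have "(\<Sum>k\<le>m. \<gamma> (Suc k)) = (\<Sum>k<m + 2. \<gamma> k) - \<gamma> 0"
      using sum.atMost_Suc_shift[of \<gamma> m] by (simp add: lessThan_Suc_atMost)
    also have "\<gamma> (m + 1) = N" using c1 by (simp add: \<gamma>_def N_def)
    finally show ?thesis using total by (simp add: algebra_simps)
  qed
  have Re_q: "Re (q r) = 0" for r
    using z(1) by (simp add: q_def Re_divide)
  \<comment> \<open>The excess over \<open>4 N\<close> in this end term decides the comparison; it is there because \<open>1 / z\<close> is imaginary.\<close>
  have "(cmod (b (m + 1)))\<^sup>2 = 4 * N + (2 * real (m + 2) / cmod z)\<^sup>2 * N"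
  proof -
    have "b (m + 1) = (2 + q (2 * real (m + 2))) * \<beta>" by (simp only: b1 distrib_right)
    then have "(cmod (b (m + 1)))\<^sup>2 = (cmod (2 + q (2 * real (m + 2))))\<^sup>2 * N"
      by (simp only: norm_mult power_mult_distrib N_def)
    also have "(cmod (2 + q (2 * real (m + 2))))\<^sup>2 = 4 + (cmod (q (2 * real (m + 2))))\<^sup>2"
      using Re_q unfolding cmod_power2 by simp
    also have "cmod (q (2 * real (m + 2))) = 2 * real (m + 2) / cmod z"
      unfolding q_def by (simp only: norm_divide norm_of_real)
    finally show ?thesis by (simp only: distrib_right)
  qed
  moreover have "8 * N \<le> 4 * \<gamma> 0 + (cmod (b 1))\<^sup>2"
    using pair[of 0] by (simp add: b0 \<gamma>_def norm_mult power_mult_distrib)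
  moreover have "real (4 * m + 6) * N = 4 * real m * N + 6 * N"
    by (simp add: algebra_simps)
  ultimately have "(2 * real (m + 2) / cmod z)\<^sup>2 * N \<le> 0"
    using upper lower[OF order_refl] unfolding Suc_eq_plus1 by linarith
  moreover have "(2 * real (m + 2) / cmod z)\<^sup>2 > 0" using z by simp
  ultimately have "N \<le> 0" by (simp add: mult_le_0_iff)
  then show ?thesis by (simp add: N_def \<beta>_def)
qed

section \<open>Chebyshev collocation of a first-order equation\<close>

lemma smult_sum_poly: "smult c (\<Sum>i\<in>I. f i) = (\<Sum>i\<in>I. smult c (f i))"
  by (induction I rule: infinite_finite_induct) (simp_all add: smult_add_right)

lemma pderiv_sum_poly: "pderiv (\<Sum>i\<in>I. f i) = (\<Sum>i\<in>I. pderiv (f i))"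
  by (induction I rule: infinite_finite_induct) (simp_all add: pderiv_add)

lemma graded_spanning:
  fixes P :: "nat \<Rightarrow> 'a::field poly"
  assumes P: "\<And>k. degree (P k) = k" "\<And>k. P k \<noteq> 0"
  shows "degree p \<le> n \<Longrightarrow> \<exists>a. p = (\<Sum>k\<le>n. smult (a k) (P k))"
proof (induction n arbitrary: p)
  case 0
  then obtain u v where "p = [:u:]" "P 0 = [:v:]"
    using P(1)[of 0] by (metis degree_0_id le_zero_eq)
  with P(2)[of 0] have "p = (\<Sum>k\<le>0. smult (u / v) (P k))" by simp
  then show ?case by (rule exI[of _ "\<lambda>_. u / v"])
next
  case (Suc n)
  define u where "u = coeff p (Suc n) / lead_coeff (P (Suc n))"
  have "coeff (p - smult u (P (Suc n))) (Suc n) = 0"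
    using P(1)[of "Suc n"] P(2)[of "Suc n"] by (simp add: u_def) (metis leading_coeff_0_iff)
  moreover have "degree (p - smult u (P (Suc n))) \<le> Suc n"
    using Suc.prems by (intro degree_diff_le) (simp_all add: P(1))
  ultimately have "degree (p - smult u (P (Suc n))) \<le> n"
    by (metis le_SucE leading_coeff_0_iff degree_0 le0)
  from Suc.IH[OF this] obtain a where "p - smult u (P (Suc n)) = (\<Sum>k\<le>n. smult (a k) (P k))"
    by blast
  then have "p = (\<Sum>k\<le>Suc n. smult ((a(Suc n := u)) k) (P k))"
    by (simp add: algebra_simps)
  then show ?case by blast
qed

lemma graded_independent:
  fixes P :: "nat \<Rightarrow> 'a::field poly"
  assumes P: "\<And>k. degree (P k) = k" "\<And>k. P k \<noteq> 0"
  shows "(\<Sum>k\<le>n. smult (a k) (P k)) = 0 \<Longrightarrow> k \<le> n \<Longrightarrow> a k = 0"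
proof (induction n arbitrary: k)
  case 0
  then show ?case using P(2)[of 0] by simp
next
  case (Suc n)
  have "coeff (\<Sum>k\<le>n. smult (a k) (P k)) (Suc n) = 0"
    by (simp add: coeff_sum P(1) coeff_eq_0)
  moreover have "coeff (\<Sum>k\<le>Suc n. smult (a k) (P k)) (Suc n) = 0"
    by (simp only: Suc.prems(1) coeff_0)
  ultimately have "a (Suc n) * lead_coeff (P (Suc n)) = 0" by (simp add: P(1))
  then have "a (Suc n) = 0" using P(2)[of "Suc n"] by simp
  with Suc show ?case by (cases "k = Suc n") auto
qed

text \<open>
  \<open>cheb_T\<close> and \<open>cheb_S\<close> are the Chebyshev polynomials of the first and second kind, the latter
  shifted: \<open>cheb_S n = U\<^sub>n\<^sub>-\<^sub>1\<close>. With this shift the derivative of \<open>T\<^sub>n\<close> is \<open>n\<close> times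
  \<open>cheb_S n\<close>, also for \<open>n = 0\<close>.
\<close>

fun cheb_T :: "nat \<Rightarrow> complex poly" where
  "cheb_T 0 = 1"
| "cheb_T (Suc 0) = [:0, 1:]"
| "cheb_T (Suc (Suc n)) = [:0, 2:] * cheb_T (Suc n) - cheb_T n"

fun cheb_S :: "nat \<Rightarrow> complex poly" where
  "cheb_S 0 = 0"
| "cheb_S (Suc 0) = 1"
| "cheb_S (Suc (Suc n)) = [:0, 2:] * cheb_S (Suc n) - cheb_S n"

lemma poly_cheb_T_1: "poly (cheb_T n) 1 = 1"
  by (induction n rule: cheb_T.induct) simp_all

lemma cheb_T_eq_S: "smult 2 (cheb_T (Suc n)) = cheb_S (Suc (Suc n)) - cheb_S n"
proof (induction n rule: cheb_S.induct)
  case (3 n)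
  have "smult 2 (cheb_T (Suc (Suc (Suc n))))
      = [:0, 2:] * smult 2 (cheb_T (Suc (Suc n))) - smult 2 (cheb_T (Suc n))"
    unfolding cheb_T.simps(3)[of "Suc n"] smult_diff_right mult_smult_right ..
  also have "\<dots> = cheb_S (Suc (Suc (Suc (Suc n)))) - cheb_S (Suc (Suc n))"
    unfolding 3 cheb_S.simps(3)[of "Suc (Suc n)"] cheb_S.simps(3)[of n] by (simp only: algebra_simps)
  finally show ?case .
qed (simp_all add: one_pCons)

lemma pderiv_cheb_T: "pderiv (cheb_T n) = smult (of_nat n) (cheb_S n)"
proof (induction n rule: cheb_T.induct)
  case (3 n)
  have "pderiv (cheb_T (Suc (Suc n)))
      = smult 2 (cheb_T (Suc n)) + [:0, 2:] * smult (of_nat (Suc n)) (cheb_S (Suc n)) - smult (of_nat n) (cheb_S n)"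
    unfolding cheb_T.simps pderiv_diff pderiv_mult 3 by (simp add: pderiv_pCons)
  also have "\<dots> = smult (of_nat (Suc (Suc n))) (cheb_S (Suc (Suc n)))"
    unfolding cheb_T_eq_S cheb_S.simps(3)
    by (simp add: poly_eq_poly_eq_iff[symmetric] fun_eq_iff algebra_simps)
  finally show ?case .
qed (simp_all add: pderiv_1 pderiv_pCons)

lemma degree_three_term:
  fixes p q :: "complex poly"
  assumes "degree p = Suc n" "degree q \<le> Suc n"
  shows "degree ([:0, 2:] * p - q) = Suc (Suc n)"
proof -
  have "degree ([:0, 2:] * p) = Suc (Suc n)"
    using assms(1) by (subst degree_mult_eq) auto
  then show ?thesis
    using assms(2) by (simp only: diff_conv_add_uminus, subst degree_add_eq_left) auto
qed

lemma degree_cheb_T: "degree (cheb_T n) = n"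
proof (induction n rule: cheb_T.induct)
  case (3 n)
  then show ?case unfolding cheb_T.simps by (intro degree_three_term) simp_all
qed simp_all

lemma degree_cheb_S: "degree (cheb_S (Suc n)) = n"
proof (induction n rule: cheb_T.induct)
  case (3 n)
  then show ?case unfolding cheb_S.simps(3)[of "Suc n"] by (intro degree_three_term) simp_all
qed simp_all

lemma cheb_nonzero: "cheb_T n \<noteq> 0" "cheb_S (Suc n) \<noteq> 0"
proof -
  show "cheb_T n \<noteq> 0" using poly_cheb_T_1[of n] by auto
  show "cheb_S (Suc n) \<noteq> 0"
    using degree_cheb_S[of n] by (cases n) auto
qed

lemma poly_cheb_S_cos:
  "poly (cheb_S n) (of_real (cos \<theta>)) * of_real (sin \<theta>) = of_real (sin (real n * \<theta>))"
proof (induction n rule: cheb_S.induct)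
  case (3 n)
  have "sin (real (Suc (Suc n)) * \<theta>) = 2 * cos \<theta> * sin (real (Suc n) * \<theta>) - sin (real n * \<theta>)"
  proof -
    have "real (Suc (Suc n)) * \<theta> = real (Suc n) * \<theta> + \<theta>" "real n * \<theta> = real (Suc n) * \<theta> - \<theta>"
      by (simp_all add: algebra_simps)
    then show ?thesis by (simp only: sin_add sin_diff) simp
  qed
  moreover have "poly (cheb_S (Suc (Suc n))) (of_real (cos \<theta>)) * of_real (sin \<theta>)
      = 2 * of_real (cos \<theta>) * (poly (cheb_S (Suc n)) (of_real (cos \<theta>)) * of_real (sin \<theta>))
        - poly (cheb_S n) (of_real (cos \<theta>)) * of_real (sin \<theta>)"
    by (simp add: algebra_simps)
  ultimately show ?case unfolding 3 by simp
qed simp_all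

lemma cheb_node_eq_iff:
  assumes "i \<le> n" "j \<le> n" "n > 0"
  shows "cos (real i * pi / real n) = cos (real j * pi / real n) \<longleftrightarrow> i = j"
proof -
  have "real i * pi / real n \<le> pi" "real j * pi / real n \<le> pi"
    using assms by (auto simp: field_simps)
  then have "real i * pi / real n = real j * pi / real n"
    if "cos (real i * pi / real n) = cos (real j * pi / real n)"
    using that by (intro cos_inj_pi[of "real i * pi / real n" "real j * pi / real n"]) auto
  then show ?thesis using assms by auto
qed

lemma chebyshev_node_root:
  assumes "j \<in> {1..n}" "n > 0"
  shows "poly ([:1, 1:] * cheb_S n) (of_real (cos (real j * pi / real n))) = 0"
proof (cases "j = n")
  case True
  then show ?thesis using assms by simp
next
  case False
  define \<theta> where "\<theta> = real j * pi / real n"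
  have "0 < \<theta>" "\<theta> < pi" using False assms by (auto simp: \<theta>_def field_simps)
  then have "sin \<theta> \<noteq> 0" using sin_gt_zero by force
  moreover have "real n * \<theta> = real j * pi" using assms by (simp add: \<theta>_def)
  then have "sin (real n * \<theta>) = 0" by (simp only: sin_npi)
  ultimately have "poly (cheb_S n) (of_real (cos \<theta>)) = 0"
    using poly_cheb_S_cos[of n \<theta>] by simp
  then show ?thesis by (simp add: \<theta>_def)
qed

lemma poly_vanishing_at_nodes:
  fixes p :: "complex poly"
  assumes n: "n > 0" and deg: "degree p \<le> n" and top: "coeff p n = 0"
    and root: "\<And>j. j \<in> {1..n} \<Longrightarrow> poly p (of_real (cos (real j * pi / real n))) = 0"
  shows "p = 0"
proof (rule ccontr)
  assume "p \<noteq> 0"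
  let ?x = "\<lambda>j. complex_of_real (cos (real j * pi / real n))"
  have "inj_on ?x {1..n}"
    using cheb_node_eq_iff n by (intro inj_onI) auto
  then have "n = card (?x ` {1..n})" by (simp add: card_image)
  also have "\<dots> \<le> card {x. poly p x = 0}"
    using root \<open>p \<noteq> 0\<close> by (intro card_mono poly_roots_finite) auto
  also have "\<dots> \<le> degree p" using \<open>p \<noteq> 0\<close> by (rule card_poly_roots_bound)
  finally have "degree p = n" using deg by simp
  then show False using top \<open>p \<noteq> 0\<close> by auto
qed

text \<open>
  The polynomial \<open>p' - z p\<close> has degree at most \<open>n\<close> and vanishes at the \<open>n\<close> nodes, hence it is a
  multiple of \<open>(1 + x) U\<^sub>n\<^sub>-\<^sub>1\<close>. Comparing coefficients in the basis of Chebyshev polynomials of the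
  second kind yields the recurrence treated above.
\<close>

lemma collocation_top_coefficient:
  fixes p :: "complex poly"
  assumes n: "n = m + 2" and deg: "degree p \<le> n" and p1: "poly p 1 = 0"
    and z: "Re z = 0" "z \<noteq> 0"
    and coll: "\<And>j. j \<in> {1..n} \<Longrightarrow> poly (pderiv p) (of_real (cos (real j * pi / real n)))
                 = z * poly p (of_real (cos (real j * pi / real n)))"
  shows "coeff p n = 0"
proof -
  obtain a where a: "p = (\<Sum>k\<le>n. smult (a k) (cheb_T k))"
    using graded_spanning[OF degree_cheb_T cheb_nonzero(1) deg] by blast
  define b where "b = (\<lambda>k. if k = 0 then 2 * a 0 else if k \<le> n then a k else 0)"
  define c where "c = (\<lambda>k. a 0 + (\<Sum>i=1..k. b i))"
  have b_high: "b k = 0" if "k > n" for k using that by (simp add: b_def)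

  have c_end: "c k = 0" if "k \<ge> n" for k
  proof -
    have "(\<Sum>i=1..k. b i) = (\<Sum>i=1..n. b i)"
      using that by (intro sum.mono_neutral_right) (auto simp: b_def)
    also have "\<dots> = (\<Sum>i=1..n. a i)" by (intro sum.cong) (auto simp: b_def)
    finally have "c k = (\<Sum>i\<le>n. a i)"
      by (simp add: c_def atMost_atLeast0 sum.atLeast_Suc_atMost)
    also have "\<dots> = poly p 1" by (simp add: a poly_sum poly_cheb_T_1)
    finally show ?thesis using p1 by simp
  qed

  have p_exp: "smult 2 p = (\<Sum>k\<le>n. smult (b k - b (Suc (Suc k))) (cheb_S (Suc k)))"
  proof -
    have "smult 2 (smult (a k) (cheb_T k)) = smult (b k) (cheb_S (Suc k)) - smult (b k) (cheb_S (k - 1))"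
      if "k \<le> n" for k
    proof (cases k)
      case (Suc i)
      have "smult 2 (smult (a k) (cheb_T k)) = smult (b k) (smult 2 (cheb_T k))"
        using that Suc by (simp add: b_def mult.commute)
      then show ?thesis unfolding Suc cheb_T_eq_S by (simp only: smult_diff_right diff_Suc_1)
    qed (simp add: b_def)
    then have "smult 2 p = (\<Sum>k\<le>n. smult (b k) (cheb_S (Suc k))) - (\<Sum>k\<le>n. smult (b k) (cheb_S (k - 1)))"
      by (simp add: a smult_sum_poly sum_subtractf)
    also have "(\<Sum>k\<le>n. smult (b k) (cheb_S (k - 1))) = (\<Sum>k\<le>Suc (Suc n). smult (b k) (cheb_S (k - 1)))"
      by (simp add: b_high)
    also have "\<dots> = (\<Sum>k\<le>n. smult (b (Suc (Suc k))) (cheb_S (Suc k)))"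
      by (subst sum.atMost_Suc_shift, subst sum.atMost_Suc_shift) simp
    finally show ?thesis by (simp add: sum_subtractf smult_diff_left)
  qed
  have dp_exp: "pderiv p = (\<Sum>k\<le>n. smult (of_nat (Suc k) * b (Suc k)) (cheb_S (Suc k)))"
  proof -
    have "pderiv p = (\<Sum>k\<le>n. smult (of_nat k * b k) (cheb_S k))"
      unfolding a pderiv_sum_poly
      by (intro sum.cong refl) (auto simp: pderiv_smult pderiv_cheb_T b_def mult.commute)
    also have "\<dots> = (\<Sum>k\<le>Suc n. smult (of_nat k * b k) (cheb_S k))"
      by (simp add: b_high)
    also have "\<dots> = (\<Sum>k\<le>n. smult (of_nat (Suc k) * b (Suc k)) (cheb_S (Suc k)))"
      by (subst sum.atMost_Suc_shift) simp
    finally show ?thesis .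
  qed

  \<comment> \<open>The coefficients of \<open>2 (1 + x) U\<^sub>n\<^sub>-\<^sub>1 = U\<^sub>n\<^sub>-\<^sub>2 + 2 U\<^sub>n\<^sub>-\<^sub>1 + U\<^sub>n\<close>.\<close>
  define \<delta> :: "nat \<Rightarrow> complex" where "\<delta> = (\<lambda>k. if k = m then 1 else if k = Suc m then 2 else if k = n then 1 else 0)"
  define f where "f = [:1, 1:] * cheb_S n"
  have f_exp: "smult 2 f = (\<Sum>k\<le>n. smult (\<delta> k) (cheb_S (Suc k)))"
  proof -
    have "(\<Sum>k\<le>n. smult (\<delta> k) (cheb_S (Suc k))) = (\<Sum>k\<in>{m, Suc m, Suc (Suc m)}. smult (\<delta> k) (cheb_S (Suc k)))"
      by (intro sum.mono_neutral_right) (auto simp: \<delta>_def n)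
    also have "\<dots> = cheb_S (Suc m) + smult 2 (cheb_S (Suc (Suc m))) + cheb_S (Suc (Suc (Suc m)))"
      by (simp add: \<delta>_def n del: cheb_S.simps)
    also have "\<dots> = smult 2 f"
    proof -
      have "smult 2 ([:1, 1:] * q) = smult 2 q + [:0, 2:] * q" for q :: "complex poly"
        by (simp add: smult_add_right)
      then show ?thesis unfolding f_def n cheb_S.simps(3)[of "Suc m"] by (simp del: cheb_S.simps)
    qed
    finally show ?thesis by simp
  qed
  have degree_f: "degree f = n"
    unfolding f_def using degree_cheb_S[of "Suc m"] cheb_nonzero(2)[of "Suc m"]
    by (subst degree_mult_eq) (auto simp: n simp del: cheb_S.simps)
  \<comment> \<open>Chosen to cancel the coefficient of degree \<open>n\<close>, so that the \<open>n\<close> nodes are too many roots.\<close>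
  define C where "C = coeff (pderiv p - smult z p) n / lead_coeff f"
  have "f \<noteq> 0" using degree_f n by auto
  have residual: "pderiv p - smult z p - smult C f = 0"
  proof (rule poly_vanishing_at_nodes)
    show "n > 0" using n by simp
    have "degree (pderiv p) \<le> n" using deg by (simp add: degree_pderiv)
    then show "degree (pderiv p - smult z p - smult C f) \<le> n"
      using deg degree_f by (intro degree_diff_le order.trans[OF degree_smult_le]) auto
    show "coeff (pderiv p - smult z p - smult C f) n = 0"
    proof -
      have "coeff f n \<noteq> 0" using \<open>f \<noteq> 0\<close> degree_f by (metis leading_coeff_0_iff)
      then show ?thesis using degree_f by (simp add: C_def)
    qed
    show "poly (pderiv p - smult z p - smult C f) (of_real (cos (real j * pi / real n))) = 0"
      if "j \<in> {1..n}" for j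
      using coll[OF that] chebyshev_node_root[OF that] n by (simp add: f_def)
  qed
  have "(\<Sum>k\<le>n. smult (of_nat (Suc k) * b (Suc k) - z / 2 * (b k - b (Suc (Suc k))) - C / 2 * \<delta> k) (cheb_S (Suc k)))
      = pderiv p - smult (z / 2) (smult 2 p) - smult (C / 2) (smult 2 f)"
    unfolding dp_exp p_exp f_exp smult_sum_poly smult_smult sum_subtractf[symmetric] smult_diff_left[symmetric] ..
  also have "\<dots> = 0" using residual by simp
  finally have "of_nat (Suc k) * b (Suc k) - z / 2 * (b k - b (Suc (Suc k))) - C / 2 * \<delta> k = 0"
    if "k \<le> n" for k
    using that by (rule graded_independent[OF degree_cheb_S cheb_nonzero(2)])
  then have rec: "of_nat (Suc k) * b (Suc k) - z / 2 * (b k - b (Suc (Suc k))) = C / 2 * \<delta> k"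
    if "k \<le> n" for k
    using that by (simp only: right_minus_eq)
  have C: "C = - (z * b n)"
    using rec[of n] b_high[of "Suc n"] b_high[of "Suc (Suc n)"] by (simp add: \<delta>_def n)
  have "b (m + 2) = 0"
  proof (rule leading_coefficient_vanishes[of z b c m])
    show "b 0 = 2 * c 0" by (simp add: b_def c_def)
    show "b (Suc k) = c (Suc k) - c k" for k by (simp add: c_def)
    show "c k = 0" if "k \<ge> m + 2" for k using c_end that n by simp
    show "of_nat (Suc k) * b (Suc k) - z / 2 * (b k - b (Suc (Suc k))) = 0" if "k < m" for k
      unfolding rec[of k] using that n by (subst rec) (auto simp: \<delta>_def)
    show "of_nat (m + 1) * b (m + 1) - z / 2 * (b m - b (m + 2)) = - (z / 2 * b (m + 2))"
      using rec[of m] n by (simp add: \<delta>_def C)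
    show "of_nat (m + 2) * b (m + 2) - z / 2 * (b (m + 1) - b (m + 3)) = - (z * b (m + 2))"
      using rec[of "m + 1"] n by (simp add: \<delta>_def C eval_nat_numeral)
  qed (use z in simp_all)
  then have "a n = 0" using n by (simp add: b_def)
  moreover have "coeff p n = a n * lead_coeff (cheb_T n)"
  proof -
    have "coeff p n = (\<Sum>k\<le>n. a k * coeff (cheb_T k) n)" by (simp add: a coeff_sum)
    also have "\<dots> = (\<Sum>k\<in>{n}. a k * coeff (cheb_T k) n)"
      by (intro sum.mono_neutral_right) (auto simp: coeff_eq_0 degree_cheb_T)
    finally show ?thesis by (simp add: degree_cheb_T)
  qed
  ultimately show ?thesis by simp
qed

text \<open>
  Once the coefficient of degree \<open>n\<close> is gone, \<open>p' - z p\<close> has more roots than its degree allows, so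
  \<open>p' = z p\<close>, and the zero polynomial is the only polynomial solution that vanishes at \<open>1\<close>. For \<open>z = 0\<close> the
  degree drops without the preceding lemma, and for \<open>n = 1\<close> the only eigenvalue is \<open>-1/2\<close>.
\<close>

theorem chebyshev_collocation_no_imaginary_eigenvalue:
  fixes p :: "complex poly"
  assumes n: "n > 0" and deg: "degree p \<le> n" and p1: "poly p 1 = 0" and z: "Re z = 0"
    and coll: "\<And>j. j \<in> {1..n} \<Longrightarrow> poly (pderiv p) (of_real (cos (real j * pi / real n)))
                 = z * poly p (of_real (cos (real j * pi / real n)))"
  shows "p = 0"
proof -
  have "coeff (smult z p) n = 0"
  proof (cases "z = 0")
    case False
    show ?thesis
    proof (cases "n = 1")
      case True
      define u v where "u = coeff p 0" "v = coeff p 1"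
      have p: "p = [:u, v:]"
        using deg True by (intro poly_eqI) (auto simp: u_v_def coeff_pCons coeff_eq_0 split: nat.splits)
      have "v = z * (u - v)" using coll[of 1] True by (simp add: p pderiv_pCons)
      moreover have "u = - v" using p1 by (simp add: p eq_neg_iff_add_eq_0)
      ultimately have "v = - (2 * z) * v" by (simp add: algebra_simps)
      then have "(1 + 2 * z) * v = 0" by (simp add: distrib_right eq_neg_iff_add_eq_0)
      moreover have "1 + 2 * z \<noteq> 0" using z by (auto simp: complex_eq_iff)
      ultimately show ?thesis using True by (simp add: p)
    next
      case n1: False
      with n have "n = (n - 2) + 2" by simp
      from collocation_top_coefficient[OF this deg p1 z False coll] show ?thesis by simp
    qed
  qed simp
  moreover have "coeff (pderiv p) n = 0"
    using deg by (simp add: coeff_pderiv coeff_eq_0)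
  ultimately have "pderiv p - smult z p = 0"
    using n deg coll
    by (intro poly_vanishing_at_nodes[of n] degree_diff_le order.trans[OF degree_smult_le])
       (auto simp: degree_pderiv)
  then have ode: "pderiv p = smult z p" by simp
  have "degree p = 0"
  proof (rule ccontr)
    assume d: "degree p \<noteq> 0"
    then have "pderiv p \<noteq> 0" by (simp add: pderiv_eq_0_iff)
    then have "degree (pderiv p) = degree p" using ode by auto
    then show False using d by (simp add: degree_pderiv)
  qed
  then obtain u where "p = [:u:]" by (rule degree_eq_zeroE)
  then show "p = 0" using p1 by simp
qed

section \<open>The spectral differentiation matrix\<close>

lemma poly_map_of_real: "poly (map_poly of_real q) (of_real x :: complex) = of_real (poly q x)"
  by (induction q) (simp_all add: map_poly_pCons)

lemma pderiv_map_of_real: "pderiv (map_poly of_real q :: complex poly) = map_poly of_real (pderiv q)"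
  by (rule poly_eqI) (simp add: coeff_pderiv coeff_map_poly)

lemma pos_bounds: "1 \<le> pos (i :: 'g::{finite,linorder})" "pos i \<le> CARD('g)"
  using bij_betw_pos[where 'g = 'g] by (auto simp: bij_betw_def)

lemma last_node: "\<exists>l. \<forall>i :: 'g::{finite,linorder}. pos i = CARD('g) \<longleftrightarrow> i = l"
proof -
  have "CARD('g) \<in> {1..CARD('g)}" by (simp add: Suc_le_eq)
  then obtain l :: 'g where "pos l = CARD('g)"
    using bij_betw_imp_surj_on[OF bij_betw_pos[where 'g = 'g]] by (metis imageE)
  moreover have "inj (pos :: 'g \<Rightarrow> nat)" using bij_betw_pos by (rule bij_betw_imp_inj_on)
  ultimately show ?thesis by (metis injD)
qed

text \<open>
  The grid on \<open>[-1, 0]\<close> is the image of the Chebyshev nodes \<open>cos (j \<pi> / (N - 1))\<close> under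
  \<open>x \<mapsto> (x - 1) / 2\<close>, with \<open>j = N - pos i\<close>; the last node corresponds to \<open>j = 0\<close>, that is \<open>x = 1\<close>.
\<close>

lemma grid_1_eq_node:
  "grid 1 (i :: 'g::{finite,linorder})
     = (cos (real (CARD('g) - pos i) * pi / real (CARD('g) - 1)) - 1) / 2"
  using pos_bounds[of i] by (simp add: grid_def of_nat_diff)

lemma inj_grid:
  assumes "CARD('g::{finite,linorder}) \<ge> 2" "grid 1 (i :: 'g) = grid 1 j"
  shows "i = j"
proof -
  have "CARD('g) - pos i = CARD('g) - pos j"
    using assms pos_bounds[of i] pos_bounds[of j] unfolding grid_1_eq_node
    by (subst cheb_node_eq_iff[symmetric, of _ "CARD('g) - 1"]) auto
  then have "pos i = pos j" using pos_bounds[of i] pos_bounds[of j] by linarith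
  then show ?thesis using bij_betw_pos[where 'g = 'g] by (auto simp: bij_betw_def inj_on_def)
qed

definition lagrange_poly :: "'g::{finite,linorder} \<Rightarrow> real poly" where
  "lagrange_poly j = (\<Prod>m\<in>UNIV - {j}. smult (1 / (grid 1 j - grid 1 m)) [:- grid 1 m, 1:])"

lemma poly_lagrange_poly: "poly (lagrange_poly j) = lagrange 1 j"
  by (simp add: fun_eq_iff lagrange_poly_def lagrange_def poly_prod diff_divide_distrib)

lemma degree_lagrange_poly: "degree (lagrange_poly (j :: 'g::{finite,linorder})) \<le> CARD('g) - 1"
proof -
  have "degree (lagrange_poly j)
      \<le> (\<Sum>m\<in>UNIV - {j}. degree (smult (1 / (grid 1 j - grid 1 m)) [:- grid 1 m, 1:]))"
    unfolding lagrange_poly_def by (rule degree_prod_sum_le[unfolded o_def]) simp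
  also have "\<dots> \<le> (\<Sum>m\<in>UNIV - {j}. 1)"
    by (intro sum_mono order.trans[OF degree_smult_le]) simp
  finally show ?thesis by (simp add: card_Diff_singleton)
qed

lemma lagrange_at_node:
  assumes "CARD('g::{finite,linorder}) \<ge> 2"
  shows "lagrange 1 (j :: 'g) (grid 1 i) = of_bool (i = j)"
proof (cases "i = j")
  case True
  have "(grid 1 i - grid 1 m) / (grid 1 j - grid 1 m) = 1" if "m \<in> UNIV - {j}" for m
    using that True inj_grid[OF assms, of j m] by auto
  then show ?thesis using True by (simp add: lagrange_def)
next
  case False
  then show ?thesis by (auto simp: lagrange_def)
qed

text \<open>
  An eigenvector whose last entry is zero consists of the nodal values of a polynomial that vanishes at
  the right end point and satisfies \<open>p' = \<mu> p\<close> at all other nodes. Rescaling the interval to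
  \<open>[-1, 1]\<close> halves the eigenvalue.
\<close>

lemma differentiation_matrix_no_imaginary_eigenvalue:
  fixes w :: "'g::{finite,linorder} \<Rightarrow> complex"
  assumes N: "CARD('g) \<ge> 2" and \<mu>: "Re \<mu> = 0"
    and last: "\<And>i. pos i = CARD('g) \<Longrightarrow> w i = 0"
    and eig: "\<And>i. pos i < CARD('g) \<Longrightarrow>
      (\<Sum>j\<in>UNIV. of_real (deriv (lagrange 1 j) (grid 1 i)) * w j) = \<mu> * w i"
  shows "w i = 0"
proof -
  define n where "n = CARD('g) - 1"
  define p where "p = (\<Sum>j\<in>UNIV. smult (w j) (map_poly of_real (lagrange_poly j)))"
  define q where "q = pcompose p [:- 1 / 2, 1 / 2:]"
  have p_node: "poly p (of_real (grid 1 i)) = w i" for i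
  proof -
    have "poly p (of_real (grid 1 i)) = (\<Sum>j\<in>UNIV. w j * of_real (of_bool (i = j)))"
      by (simp add: p_def poly_sum poly_map_of_real poly_lagrange_poly lagrange_at_node[OF N])
    also have "\<dots> = (\<Sum>j\<in>UNIV. if j = i then w j else 0)"
      by (intro sum.cong) auto
    also have "\<dots> = w i" by simp
    finally show ?thesis .
  qed
  have dp_node: "poly (pderiv p) (of_real (grid 1 i)) = \<mu> * w i" if "pos i < CARD('g)" for i
  proof -
    have "deriv (lagrange 1 j) x = poly (pderiv (lagrange_poly j)) x" for j :: 'g and x
      unfolding poly_lagrange_poly[symmetric] by (rule DERIV_imp_deriv[OF poly_DERIV])
    then have "poly (pderiv p) (of_real (grid 1 i)) = (\<Sum>j\<in>UNIV. of_real (deriv (lagrange 1 j) (grid 1 i)) * w j)"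
      by (simp add: p_def pderiv_sum_poly pderiv_smult pderiv_map_of_real poly_sum poly_map_of_real mult.commute)
    then show ?thesis using eig[OF that] by simp
  qed
  have node: "poly [:- 1 / 2, 1 / 2:] (of_real (cos (real (CARD('g) - pos i) * pi / real n))) = complex_of_real (grid 1 i)"
    for i :: 'g
    by (simp add: grid_1_eq_node n_def field_simps)
  have degree_map_of_real: "degree (map_poly of_real (lagrange_poly j) :: complex poly) \<le> CARD('g) - 1"
    for j :: 'g
    using degree_lagrange_poly[of j] by (intro degree_le) (simp add: coeff_map_poly coeff_eq_0)
  have "degree p \<le> n"
    unfolding p_def n_def
    by (intro degree_sum_le order.trans[OF degree_smult_le] degree_map_of_real) simp
  have "q = 0"
  proof (rule chebyshev_collocation_no_imaginary_eigenvalue[of n q "\<mu> / 2"])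
    show "n > 0" using N by (simp add: n_def)
    show "degree q \<le> n" using \<open>degree p \<le> n\<close> by (simp add: q_def degree_pcompose)
    obtain l :: 'g where "\<And>i. pos i = CARD('g) \<longleftrightarrow> i = l"
      using last_node[where 'g = 'g] by blast
    then have l: "pos l = CARD('g)" by blast
    show "poly q 1 = 0"
      using node[of l] p_node[of l] last[OF l] by (simp add: q_def poly_pcompose l)
    show "Re (\<mu> / 2) = 0" using \<mu> by simp
    show "poly (pderiv q) (of_real (cos (real j * pi / real n)))
        = \<mu> / 2 * poly q (of_real (cos (real j * pi / real n)))" if j: "j \<in> {1..n}" for j
    proof -
      have "CARD('g) - j \<in> {1..CARD('g)}" using j by (auto simp: n_def)
      then obtain i :: 'g where "pos i = CARD('g) - j"
        using bij_betw_imp_surj_on[OF bij_betw_pos[where 'g = 'g]] by (metis imageE)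
      then have i: "CARD('g) - pos i = j" "pos i < CARD('g)" using j by (auto simp: n_def)
      have "poly (pderiv q) (of_real (cos (real j * pi / real n))) = poly (pderiv p) (of_real (grid 1 i)) / 2"
        using node[of i] unfolding i(1) by (simp add: q_def pderiv_pcompose poly_pcompose pderiv_pCons)
      moreover have "poly q (of_real (cos (real j * pi / real n))) = poly p (of_real (grid 1 i))"
        using node[of i] unfolding i(1) by (simp add: q_def poly_pcompose)
      ultimately show ?thesis using dp_node[OF i(2)] p_node[of i] by simp
    qed
  qed
  then have "poly p (of_real (grid 1 i)) = 0"
    using node[of i] by (metis poly_0 poly_pcompose q_def)
  then show ?thesis using p_node by simp
qed

section \<open>Square roots of positive semidefinite matrices\<close>

lemma inner_matrix_transpose:
  fixes X :: "real^'n^'m"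
  shows "x \<bullet> (X *v y) = (transpose X *v x) \<bullet> y"
  by (simp add: dot_lmul_matrix transpose_matrix_vector)

text \<open>
  A maximiser of the quadratic form on the unit sphere of an invariant subspace is an eigenvector:
  its defect \<open>d = X x - (x \<bullet> X x) x\<close> lies in the subspace, and moving from \<open>x\<close> in the direction \<open>d\<close> would
  raise the form to first order if \<open>d\<close> were nonzero.
\<close>

lemma rayleigh_eigenvector:
  fixes X :: "real^'n^'n"
  assumes sym: "transpose X = X" and W: "subspace W" and inv: "\<And>y. y \<in> W \<Longrightarrow> X *v y \<in> W"
    and ne: "w \<in> W" "w \<noteq> 0"
  obtains x where "x \<in> W" "norm x = 1" "X *v x = (x \<bullet> (X *v x)) *\<^sub>R x"
proof -
  let ?q = "\<lambda>x. x \<bullet> (X *v x)"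
  let ?K = "W \<inter> sphere 0 1"
  have "compact ?K"
    using closed_subspace[OF W] by (intro closed_Int_compact compact_sphere)
  moreover have "w /\<^sub>R norm w \<in> ?K"
    using ne W by (simp add: subspace_scale)
  moreover have "continuous_on ?K ?q"
    by (intro continuous_on_inner continuous_on_id linear_continuous_on matrix_vector_mul_bounded_linear)
  ultimately obtain x where x: "x \<in> ?K" and max: "\<And>y. y \<in> ?K \<Longrightarrow> ?q y \<le> ?q x"
    using continuous_attains_sup[of ?K ?q] by blast
  have scaled: "?q u \<le> ?q x * (u \<bullet> u)" if "u \<in> W" for u
  proof (cases "u = 0")
    case False
    have "u /\<^sub>R norm u \<in> ?K" using that False W by (simp add: subspace_scale)
    from max[OF this] have "?q u / (norm u)\<^sup>2 \<le> ?q x"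
      by (simp add: matrix_vector_mult_scaleR power2_eq_square divide_inverse mult_ac)
    then show ?thesis using False by (simp add: field_simps dot_square_norm)
  qed simp
  define d where "d = X *v x - ?q x *\<^sub>R x"
  have dW: "d \<in> W" using x inv W by (auto simp: d_def subspace_diff subspace_scale)
  have x1: "x \<bullet> x = 1" using x by (simp add: dot_square_norm)
  have expand: "?q (x + t *\<^sub>R d) - ?q x * ((x + t *\<^sub>R d) \<bullet> (x + t *\<^sub>R d))
      = 2 * t * (d \<bullet> d) + t\<^sup>2 * (?q d - ?q x * (d \<bullet> d))" for t
  proof -
    have "x \<bullet> (X *v d) = d \<bullet> (X *v x)"
      using inner_matrix_transpose[of x X d] sym by (simp add: inner_commute)
    moreover have "d \<bullet> (X *v x) = d \<bullet> d + ?q x * (d \<bullet> x)"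
      by (subst (3) d_def) (simp add: inner_diff_right)
    ultimately show ?thesis
      using x1 by (simp add: matrix_vector_right_distrib matrix_vector_mult_scaleR inner_add_left
        inner_add_right inner_commute power2_eq_square algebra_simps)
  qed
  have quad: "2 * t * (d \<bullet> d) + t\<^sup>2 * (?q d - ?q x * (d \<bullet> d)) \<le> 0" for t
    using scaled[of "x + t *\<^sub>R d"] x dW W unfolding expand[symmetric]
    by (simp add: subspace_add subspace_scale)
  have "d \<bullet> d = 0"
  proof (rule ccontr)
    assume "d \<bullet> d \<noteq> 0"
    then have pos: "d \<bullet> d > 0" by (simp add: less_le)
    \<comment> \<open>The step \<open>t\<close> is small enough for the first-order term to dominate the second-order one.\<close>
    define k where "k = \<bar>?q d - ?q x * (d \<bullet> d)\<bar> + 1"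
    define t where "t = (d \<bullet> d) / k"
    have k: "k > 0" "- k \<le> ?q d - ?q x * (d \<bullet> d)" by (auto simp: k_def)
    have t: "t > 0" using pos k by (simp add: t_def)
    have "0 < t * (d \<bullet> d)" using t pos by simp
    also have "\<dots> = 2 * t * (d \<bullet> d) + t\<^sup>2 * (- k)"
      using k by (simp add: t_def power2_eq_square field_simps)
    also have "\<dots> \<le> 2 * t * (d \<bullet> d) + t\<^sup>2 * (?q d - ?q x * (d \<bullet> d))"
      using k by (intro add_left_mono mult_left_mono) auto
    finally show False using quad[of t] by simp
  qed
  then have "X *v x = ?q x *\<^sub>R x" by (simp add: d_def)
  then show thesis by (rule that[rotated 2]) (use x in auto)
qed

text \<open>
  Take an orthonormal set of eigenvectors of maximal size. Its orthogonal complement is invariant, so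
  if it were nonzero it would contain a further unit eigenvector.
\<close>

lemma orthonormal_eigenbasis:
  fixes X :: "real^'n^'n"
  assumes sym: "transpose X = X"
  obtains B where "finite B" "\<And>b. b \<in> B \<Longrightarrow> norm b = 1" "pairwise orthogonal B"
    "\<And>b. b \<in> B \<Longrightarrow> X *v b = (b \<bullet> (X *v b)) *\<^sub>R b"
    "\<And>y. (\<And>b. b \<in> B \<Longrightarrow> b \<bullet> y = 0) \<Longrightarrow> y = 0"
proof -
  let ?P = "\<lambda>B. (\<forall>b\<in>B. norm b = 1 \<and> X *v b = (b \<bullet> (X *v b)) *\<^sub>R b) \<and> pairwise orthogonal B"
  have bound: "finite B \<and> card B \<le> CARD('n)" if "?P B" for B
  proof -
    have "independent B"
      using that by (intro pairwise_orthogonal_independent) auto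
    then show ?thesis using independent_bound[of B] by simp
  qed
  have "\<exists>B. ?P B \<and> (\<forall>B'. ?P B' \<longrightarrow> card B' \<le> card B)"
    by (rule ex_has_greatest_nat[of ?P "{}" card "CARD('n) + 1"]) (use bound in \<open>auto simp: less_Suc_eq_le\<close>)
  then obtain B where B: "?P B" and max: "\<And>B'. ?P B' \<Longrightarrow> card B' \<le> card B" by blast
  have "y = 0" if y: "\<And>b. b \<in> B \<Longrightarrow> b \<bullet> y = 0" for y
  proof (rule ccontr)
    assume "y \<noteq> 0"
    define W where "W = {u. \<forall>b\<in>B. b \<bullet> u = 0}"
    have W: "subspace W" unfolding W_def subspace_def by (simp add: inner_add_right)
    have "X *v u \<in> W" if "u \<in> W" for u
      unfolding W_def
    proof (intro CollectI ballI)
      fix b assume b: "b \<in> B"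
      have "b \<bullet> (X *v u) = (X *v b) \<bullet> u" using inner_matrix_transpose[of b X u] sym by simp
      also have "X *v b = (b \<bullet> (X *v b)) *\<^sub>R b" using B b by blast
      finally show "b \<bullet> (X *v u) = 0" using that b by (simp add: W_def)
    qed
    moreover have "y \<in> W" using y by (simp add: W_def)
    ultimately obtain x where x: "x \<in> W" "norm x = 1" "X *v x = (x \<bullet> (X *v x)) *\<^sub>R x"
      using rayleigh_eigenvector[OF sym W] \<open>y \<noteq> 0\<close> by metis
    have "x \<notin> B"
      using x(1,2) by (auto simp: W_def)
    moreover have "?P (insert x B)"
      using B x by (auto simp: pairwise_insert orthogonal_def inner_commute W_def)
    then have "card (insert x B) \<le> card B" by (rule max)
    ultimately show False using bound[OF B] by simp
  qed
  with that[of B] B bound[OF B] show thesis by blast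
qed

lemma psd_square_root_exists:
  fixes X :: "real^'n^'n"
  assumes "0 \<preceq>\<^sub>L X"
  shows "\<exists>S. 0 \<preceq>\<^sub>L S \<and> S ** S = X"
proof -
  have sym: "transpose X = X" and psd: "\<And>x. 0 \<le> x \<bullet> (X *v x)"
    using assms by (auto simp: loewner_le_def)
  obtain B where B: "finite B" "\<And>b. b \<in> B \<Longrightarrow> norm b = 1" "pairwise orthogonal B"
    "\<And>b. b \<in> B \<Longrightarrow> X *v b = (b \<bullet> (X *v b)) *\<^sub>R b"
    "\<And>y. (\<And>b. b \<in> B \<Longrightarrow> b \<bullet> y = 0) \<Longrightarrow> y = 0"
    using orthonormal_eigenbasis[OF sym] by metis
  define r where "r = (\<lambda>b. sqrt (b \<bullet> (X *v b)))"
  define S :: "real^'n^'n" where "S = (\<chi> i j. \<Sum>b\<in>B. r b * b $ i * b $ j)"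
  have inner_B: "b \<bullet> b' = (if b' = b then 1 else 0)" if "b \<in> B" "b' \<in> B" for b b'
    using that B(2)[of b] B(3) by (auto simp: dot_square_norm pairwise_def orthogonal_def)
  have Sy: "S *v y = (\<Sum>b\<in>B. (r b * (b \<bullet> y)) *\<^sub>R b)" for y
  proof (rule vec_eq_iff[THEN iffD2], rule allI)
    fix i
    have "(S *v y) $ i = (\<Sum>j\<in>UNIV. \<Sum>b\<in>B. r b * b $ i * b $ j * y $ j)"
      by (simp add: matrix_vector_mult_def S_def sum_distrib_right)
    also have "\<dots> = (\<Sum>b\<in>B. \<Sum>j\<in>UNIV. r b * b $ i * b $ j * y $ j)" by (rule sum.swap)
    also have "\<dots> = (\<Sum>b\<in>B. (r b * (b \<bullet> y)) *\<^sub>R b) $ i"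
      by (simp add: inner_vec_def sum_distrib_left sum_distrib_right mult_ac)
    finally show "(S *v y) $ i = (\<Sum>b\<in>B. (r b * (b \<bullet> y)) *\<^sub>R b) $ i" .
  qed
  have bS: "b \<bullet> (S *v y) = r b * (b \<bullet> y)" if "b \<in> B" for b y
  proof -
    have "b \<bullet> (S *v y) = (\<Sum>b'\<in>B. r b' * (b' \<bullet> y) * (b \<bullet> b'))"
      by (simp add: Sy inner_sum_right)
    also have "\<dots> = (\<Sum>b'\<in>B. if b' = b then r b * (b \<bullet> y) else 0)"
      by (intro sum.cong refl) (simp add: inner_B[OF that])
    finally show ?thesis using that B(1) by simp
  qed
  have "S *v (S *v y) = X *v y" for y
  proof -
    have "b \<bullet> (S *v (S *v y) - X *v y) = 0" if b: "b \<in> B" for b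
    proof -
      have "b \<bullet> (X *v y) = (X *v b) \<bullet> y" using inner_matrix_transpose[of b X y] sym by simp
      also have "\<dots> = (b \<bullet> (X *v b)) * (b \<bullet> y)" by (subst B(4)[OF b]) simp
      also have "b \<bullet> (X *v b) = r b * r b" using psd by (simp add: r_def)
      finally show ?thesis by (simp add: inner_diff_right bS[OF b])
    qed
    then show ?thesis using B(5) by (metis right_minus_eq)
  qed
  then have "S ** S = X" by (simp add: matrix_eq matrix_vector_mul_assoc[symmetric])
  moreover have "transpose S = S"
    by (simp add: S_def transpose_def vec_eq_iff mult_ac)
  moreover have "0 \<le> y \<bullet> (S *v y)" for y
  proof -
    have "y \<bullet> (S *v y) = (\<Sum>b\<in>B. r b * (b \<bullet> y)\<^sup>2)"
      by (simp add: Sy inner_sum_right power2_eq_square inner_commute mult_ac)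
    also have "\<dots> \<ge> 0" using psd by (intro sum_nonneg) (simp add: r_def)
    finally show ?thesis .
  qed
  moreover have "transpose (0 :: real^'n^'n) = 0" by (simp add: transpose_def vec_eq_iff)
  ultimately show ?thesis by (auto simp: loewner_le_def)
qed

text \<open>
  If \<open>b\<close> is an eigenvector of \<open>S - T\<close> with
  eigenvalue \<open>\<mu>\<close>, then \<open>S\<^sup>2 - T\<^sup>2 = S (S - T) + (S - T) T\<close> gives \<open>\<mu> (b \<bullet> S b + b \<bullet> T b) = 0\<close>. Both
  summands are nonnegative, and \<open>\<mu>\<close> is their difference when \<open>b\<close> is a unit vector, so \<open>\<mu> = 0\<close> in any case.
\<close>

lemma psd_square_root_unique:
  fixes S T :: "real^'n^'n"
  assumes S: "0 \<preceq>\<^sub>L S" and T: "0 \<preceq>\<^sub>L T" and eq: "S ** S = T ** T"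
  shows "S = T"
proof -
  have sym: "transpose S = S" "transpose T = T" using S T by (auto simp: loewner_le_def)
  have psd: "0 \<le> x \<bullet> (S *v x)" "0 \<le> x \<bullet> (T *v x)" for x
    using S T by (auto simp: loewner_le_def)
  have "transpose (S - T) = S - T"
    using sym by (simp add: transpose_def vec_eq_iff)
  then obtain B where B: "\<And>b. b \<in> B \<Longrightarrow> (S - T) *v b = (b \<bullet> ((S - T) *v b)) *\<^sub>R b"
    "\<And>y. (\<And>b. b \<in> B \<Longrightarrow> b \<bullet> y = 0) \<Longrightarrow> y = 0"
    using orthonormal_eigenbasis[of "S - T"] by metis
  have kernel: "(S - T) *v b = 0" if "b \<in> B" for b
  proof -
    define \<mu> where "\<mu> = b \<bullet> ((S - T) *v b)"
    have Db: "(S - T) *v b = \<mu> *\<^sub>R b" using B(1)[OF that] by (simp add: \<mu>_def)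
    have "b \<bullet> (S *v ((S - T) *v b)) + ((S - T) *v b) \<bullet> (T *v b)
        = b \<bullet> ((S ** S) *v b) - b \<bullet> ((T ** T) *v b)"
      using inner_matrix_transpose[of b S "T *v b"] sym
      by (simp add: matrix_vector_mult_diff_distrib matrix_vector_mult_diff_rdistrib inner_diff_left inner_diff_right
        inner_matrix_transpose[of b T] matrix_vector_mul_assoc[symmetric])
    then have "\<mu> * (b \<bullet> (S *v b) + b \<bullet> (T *v b)) = 0"
      unfolding Db by (simp add: eq matrix_vector_mult_scaleR distrib_left)
    then have "\<mu> = 0 \<or> b \<bullet> (S *v b) = 0 \<and> b \<bullet> (T *v b) = 0"
      using psd[of b] by (simp add: add_nonneg_eq_0_iff)
    then have "\<mu> = 0"
      by (auto simp: \<mu>_def matrix_vector_mult_diff_rdistrib inner_diff_right)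
    then show ?thesis by (simp add: Db)
  qed
  have "(S - T) *v y = 0" for y
  proof (rule B(2))
    fix b assume "b \<in> B"
    then show "b \<bullet> ((S - T) *v y) = 0"
      using inner_matrix_transpose[of b "S - T" y] \<open>transpose (S - T) = S - T\<close> kernel by simp
  qed
  then have "S - T = 0" by (simp add: matrix_eq)
  then show ?thesis by simp
qed

lemma psd_sqrt:
  assumes "0 \<preceq>\<^sub>L X"
  shows "transpose (psd_sqrt X) = psd_sqrt X" "psd_sqrt X ** psd_sqrt X = X"
proof -
  have "\<exists>!S. 0 \<preceq>\<^sub>L S \<and> S ** S = X"
    using psd_square_root_exists[OF assms] psd_square_root_unique by metis
  then have "0 \<preceq>\<^sub>L psd_sqrt X \<and> psd_sqrt X ** psd_sqrt X = X"
    unfolding psd_sqrt_def by (rule theI')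
  then show "transpose (psd_sqrt X) = psd_sqrt X" "psd_sqrt X ** psd_sqrt X = X"
    by (auto simp: loewner_le_def)
qed

lemma inner_psd_sqrt:
  assumes "0 \<preceq>\<^sub>L X"
  shows "x \<bullet> (X *v x) = (norm (psd_sqrt X *v x))\<^sup>2"
proof -
  have "x \<bullet> (X *v x) = x \<bullet> (psd_sqrt X *v (psd_sqrt X *v x))"
    by (simp only: matrix_vector_mul_assoc psd_sqrt(2)[OF assms])
  also have "\<dots> = (psd_sqrt X *v x) \<bullet> (psd_sqrt X *v x)"
    by (simp only: inner_matrix_transpose[of x] psd_sqrt(1)[OF assms])
  finally show ?thesis by (simp add: dot_square_norm)
qed

section \<open>Eigenvalues along a path of matrices\<close>

text \<open>
  Splitting an eigenvector into real and imaginary parts lets the real quadratic forms of a Lyapunov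
  argument act on it directly.
\<close>

lemma eigenvalues_real_pair_iff:
  fixes X :: "real^'n^'n"
  shows "z \<in> eigenvalues X \<longleftrightarrow> (\<exists>a b. (a \<noteq> 0 \<or> b \<noteq> 0) \<and>
    X *v a = Re z *\<^sub>R a - Im z *\<^sub>R b \<and> X *v b = Im z *\<^sub>R a + Re z *\<^sub>R b)"
    (is "_ \<longleftrightarrow> (\<exists>a b. ?pair a b)")
proof
  assume "z \<in> eigenvalues X"
  then obtain v where v: "v \<noteq> 0" "map_matrix complex_of_real X *v v = z *s v"
    by (auto simp: eigenvalues_def)
  have eq: "(\<Sum>j\<in>UNIV. complex_of_real (X $ i $ j) * v $ j) = z * v $ i" for i
    using arg_cong[OF v(2), of "\<lambda>u. u $ i"] by (simp add: matrix_vector_mult_def)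
  have "?pair (\<chi> i. Re (v $ i)) (\<chi> i. Im (v $ i))"
    using v(1) arg_cong[OF eq, of Re] arg_cong[OF eq, of Im]
    by (auto simp: vec_eq_iff matrix_vector_mult_def complex_eq_iff algebra_simps)
  then show "\<exists>a b. ?pair a b" by blast
next
  assume "\<exists>a b. ?pair a b"
  then obtain a b where ab: "?pair a b" by blast
  define v :: "complex^'n" where "v = (\<chi> i. Complex (a $ i) (b $ i))"
  have "v \<noteq> 0" using ab by (auto simp: v_def vec_eq_iff complex_eq_iff)
  moreover have "map_matrix complex_of_real X *v v = z *s v"
  proof (rule vec_eq_iff[THEN iffD2], rule allI)
    fix i
    have "(X *v a) $ i = (Re z *\<^sub>R a - Im z *\<^sub>R b) $ i" "(X *v b) $ i = (Im z *\<^sub>R a + Re z *\<^sub>R b) $ i"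
      using ab by simp_all
    then show "(map_matrix complex_of_real X *v v) $ i = (z *s v) $ i"
      by (simp add: v_def matrix_vector_mult_def complex_eq_iff algebra_simps)
  qed
  ultimately show "z \<in> eigenvalues X" by (auto simp: eigenvalues_def)
qed

definition char_det :: "real^'n^'n \<Rightarrow> complex \<Rightarrow> complex" where
  "char_det X z = det (mat z - map_matrix complex_of_real X)"

lemma char_det_eq_0_iff: "char_det X z = 0 \<longleftrightarrow> z \<in> eigenvalues X"
proof -
  have mat: "mat z *v v = z *s v" for v :: "complex^'n"
    by (simp add: vec_eq_iff matrix_vector_mult_def mat_def if_distrib[of "\<lambda>c. c * _"] cong: if_cong)
  have "char_det X z \<noteq> 0 \<longleftrightarrow> (\<forall>v. (mat z - map_matrix complex_of_real X) *v v = 0 \<longrightarrow> v = 0)"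
    unfolding char_det_def invertible_det_nz[symmetric] invertible_left_inverse
    by (rule matrix_left_invertible_ker)
  then show ?thesis
    by (auto simp: eigenvalues_def matrix_vector_mult_diff_rdistrib mat)
qed

lemma char_det_expand:
  "char_det X z = (\<Sum>p | p permutes UNIV. of_int (sign p) *
     (\<Prod>i\<in>UNIV. of_bool (i = p i) * z - complex_of_real (X $ i $ p i)))"
  by (auto simp: char_det_def det_def mat_def intro!: sum.cong prod.cong)

lemma holomorphic_char_det: "char_det X holomorphic_on S"
  unfolding char_det_expand[abs_def]
  by (intro holomorphic_intros)

lemma continuous_on_char_det:
  fixes A :: "real \<Rightarrow> real^'n^'n"
  assumes "continuous_on T A"
  shows "continuous_on (T \<times> S) (\<lambda>(t, z). char_det (A t) z)"
proof -
  have "continuous_on (T \<times> S) (\<lambda>x. A (fst x))"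
    by (rule continuous_on_compose2[OF assms]) (auto intro!: continuous_intros)
  then show ?thesis
    unfolding char_det_expand case_prod_beta
    by (intro continuous_intros)
qed

lemma eigenvalue_bound:
  fixes X :: "real^'n^'n"
  assumes "z \<in> eigenvalues X"
  shows "cmod z \<le> (\<Sum>i\<in>UNIV. \<Sum>j\<in>UNIV. \<bar>X $ i $ j\<bar>)"
proof -
  obtain v where v: "v \<noteq> 0" "map_matrix complex_of_real X *v v = z *s v"
    using assms by (auto simp: eigenvalues_def)
  define s where "s = (\<Sum>i\<in>UNIV. cmod (v $ i))"
  have le_s: "cmod (v $ i) \<le> s" for i
    unfolding s_def by (rule member_le_sum) auto
  obtain k where "v $ k \<noteq> 0" using v(1) by (auto simp: vec_eq_iff)
  then have "s > 0" using le_s[of k] by (smt (verit) zero_less_norm_iff)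
  have "cmod z * s = (\<Sum>i\<in>UNIV. cmod (z * v $ i))"
    by (simp add: s_def norm_mult sum_distrib_left)
  also have "\<dots> = (\<Sum>i\<in>UNIV. cmod (\<Sum>j\<in>UNIV. complex_of_real (X $ i $ j) * v $ j))"
    using v(2) by (simp add: vec_eq_iff matrix_vector_mult_def)
  also have "\<dots> \<le> (\<Sum>i\<in>UNIV. \<Sum>j\<in>UNIV. \<bar>X $ i $ j\<bar> * s)"
  proof (intro sum_mono)
    fix i
    have "cmod (\<Sum>j\<in>UNIV. complex_of_real (X $ i $ j) * v $ j)
        \<le> (\<Sum>j\<in>UNIV. cmod (complex_of_real (X $ i $ j) * v $ j))"
      by (rule norm_sum)
    also have "\<dots> \<le> (\<Sum>j\<in>UNIV. \<bar>X $ i $ j\<bar> * s)"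
      by (intro sum_mono) (simp add: norm_mult mult_left_mono le_s)
    finally show "cmod (\<Sum>j\<in>UNIV. complex_of_real (X $ i $ j) * v $ j) \<le> (\<Sum>j\<in>UNIV. \<bar>X $ i $ j\<bar> * s)" .
  qed
  also have "\<dots> = (\<Sum>i\<in>UNIV. \<Sum>j\<in>UNIV. \<bar>X $ i $ j\<bar>) * s"
    by (simp add: sum_distrib_right)
  finally show ?thesis using \<open>s > 0\<close> by simp
qed

text \<open>
  Eigenvalues depend continuously on the matrix: by the theorem of Hurwitz, a locally uniform limit of
  holomorphic functions without zeros in the right half-plane has no zero there, unless it is
  constant. The characteristic determinant is not constant there, since eigenvalues are bounded.
\<close>

lemma limit_no_eigenvalue_right_half_plane:
  fixes A :: "real \<Rightarrow> real^'n^'n"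
  assumes cont: "continuous_on {0..1} A"
    and x: "\<And>k. x k \<in> {0..1}" "x \<longlonglongrightarrow> s"
    and good: "\<And>k z. z \<in> eigenvalues (A (x k)) \<Longrightarrow> Re z \<le> 0"
    and z: "z \<in> eigenvalues (A s)"
  shows "Re z \<le> 0"
proof (rule ccontr)
  assume "\<not> Re z \<le> 0"
  let ?H = "{z. Re z > 0}"
  have s: "s \<in> {0..1}"
    by (rule closed_sequentially[OF _ x]) simp
  have "char_det (A s) z \<noteq> 0"
  proof (rule Hurwitz_no_zeros[of ?H "\<lambda>k. char_det (A (x k))" "char_det (A s)"])
    show "open ?H" by (rule open_halfspace_Re_gt)
    show "connected ?H" by (intro convex_connected convex_halfspace_Re_gt)
    show "uniform_limit K (\<lambda>k. char_det (A (x k))) (char_det (A s)) sequentially"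
      if K: "compact K" "K \<subseteq> ?H" for K
    proof (rule uniform_limitI)
      fix e :: real assume "e > 0"
      have "uniformly_continuous_on ({0..1} \<times> K) (\<lambda>(t, z). char_det (A t) z)"
        using K(1) by (intro compact_uniformly_continuous continuous_on_char_det cont compact_Times compact_Icc)
      then obtain d where d: "d > 0" and close: "\<And>p q. p \<in> {0..1} \<times> K \<Longrightarrow> q \<in> {0..1} \<times> K \<Longrightarrow> dist q p < d
          \<Longrightarrow> dist (case q of (t, z) \<Rightarrow> char_det (A t) z) (case p of (t, z) \<Rightarrow> char_det (A t) z) < e"
        using \<open>e > 0\<close> unfolding uniformly_continuous_on_def by metis
      have "\<forall>\<^sub>F k in sequentially. dist (x k) s < d"
        using x(2) d by (rule tendstoD)
      then show "\<forall>\<^sub>F k in sequentially. \<forall>w\<in>K. dist (char_det (A (x k)) w) (char_det (A s) w) < e"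
      proof eventually_elim
        case (elim k)
        show ?case
        proof
          fix w assume "w \<in> K"
          then show "dist (char_det (A (x k)) w) (char_det (A s) w) < e"
            using close[of "(s, w)" "(x k, w)"] s x(1)[of k] elim by (simp add: dist_Pair_Pair)
        qed
      qed
    qed
    show "\<not> char_det (A s) constant_on ?H"
    proof
      assume "char_det (A s) constant_on ?H"
      then obtain c where c: "\<And>w. w \<in> ?H \<Longrightarrow> char_det (A s) w = c"
        by (auto simp: constant_on_def)
      define M where "M = (\<Sum>i\<in>UNIV. \<Sum>j\<in>UNIV. \<bar>A s $ i $ j\<bar>)"
      have "M \<ge> 0" by (simp add: M_def sum_nonneg)
      then have "complex_of_real (M + 1) \<in> ?H" by simp
      moreover have "char_det (A s) z = 0" using z by (simp add: char_det_eq_0_iff)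
      ultimately have "char_det (A s) (complex_of_real (M + 1)) = 0"
        using c[of z] c[of "complex_of_real (M + 1)"] \<open>\<not> Re z \<le> 0\<close> by simp
      then have "cmod (complex_of_real (M + 1)) \<le> M"
        unfolding char_det_eq_0_iff M_def by (rule eigenvalue_bound)
      then show False using \<open>M \<ge> 0\<close> unfolding norm_of_real by simp
    qed
    show "char_det (A (x k)) w \<noteq> 0" if "w \<in> ?H" for k w
      using good[of w k] that by (auto simp: char_det_eq_0_iff)
    show "z \<in> ?H" using \<open>\<not> Re z \<le> 0\<close> by simp
  qed (rule holomorphic_char_det)+
  then show False using z by (simp add: char_det_eq_0_iff)
qed

text \<open>
  An eigenvalue can reach the right half-plane only through the imaginary axis. The parameters at
  which some eigenvalue has nonnegative real part form a compact set. At its least element, every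
  eigenvalue is a limit from the left half-plane and so has real part at most zero; equality is
  excluded below \<open>1\<close> and the start excludes \<open>0\<close>, so this element can only be \<open>1\<close> itself, where the weak inequality remains.
\<close>

theorem hurwitz_homotopy:
  fixes A :: "real \<Rightarrow> real^'n^'n"
  assumes cont: "continuous_on {0..1} A" and start: "hurwitz (A 0)"
    and no_imag: "\<And>t z. 0 < t \<Longrightarrow> t < 1 \<Longrightarrow> z \<in> eigenvalues (A t) \<Longrightarrow> Re z \<noteq> 0"
    and z: "z \<in> eigenvalues (A 1)"
  shows "Re z \<le> 0"
proof -
  define N where "N = {t \<in> {0..1}. \<exists>z\<in>eigenvalues (A t). Re z \<ge> 0}"
  have "compact N"
  proof -
    define q where "q = (\<lambda>t. \<Sum>i\<in>UNIV. \<Sum>j\<in>UNIV. \<bar>A t $ i $ j\<bar>)"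
    have "continuous_on {0..1} q"
      unfolding q_def by (intro continuous_intros cont)
    then obtain u where u: "\<forall>t\<in>{0..1}. q t \<le> q u"
      using continuous_attains_sup[of "{0..1::real}" q] by auto
    define M where "M = q u"
    \<comment> \<open>The exceptional parameters are the projection of a compact set of pairs of a parameter and an eigenvalue.\<close>
    let ?D = "{0..1::real} \<times> (cball 0 M \<inter> {z. Re z \<ge> 0})"
    define E where "E = {p \<in> ?D. (case p of (t, z) \<Rightarrow> char_det (A t) z) = 0}"
    have "compact ?D"
      by (intro compact_Times compact_Int_closed closed_halfspace_Re_ge compact_Icc compact_cball)
    moreover have "closed E"
      unfolding E_def using \<open>compact ?D\<close>
      by (intro continuous_closed_preimage_constant continuous_on_char_det cont compact_imp_closed)
    ultimately have "compact E"
      using compact_Int_closed[of ?D E] by (simp add: E_def Int_absorb1 Collect_restrict)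
    moreover have "N = fst ` E"
    proof
      show "N \<subseteq> fst ` E"
      proof
        fix t assume "t \<in> N"
        then obtain w where w: "t \<in> {0..1}" "w \<in> eigenvalues (A t)" "Re w \<ge> 0" by (auto simp: N_def)
        then have "(t, w) \<in> E"
          using eigenvalue_bound[OF w(2)] u by (force simp: E_def M_def q_def char_det_eq_0_iff)
        then show "t \<in> fst ` E" by force
      qed
      show "fst ` E \<subseteq> N" by (auto simp: E_def N_def char_det_eq_0_iff)
    qed
    ultimately show ?thesis
      by (simp add: compact_continuous_image continuous_on_fst)
  qed
  have left_limit: "Re w \<le> 0"
    if s: "0 < s" "s \<le> 1" and below: "\<And>t. 0 \<le> t \<Longrightarrow> t < s \<Longrightarrow> t \<notin> N" and w: "w \<in> eigenvalues (A s)" for s w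
  proof (rule limit_no_eigenvalue_right_half_plane[OF cont _ _ _ w])
    let ?x = "\<lambda>k. s - s / real (k + 2)"
    have x: "0 \<le> ?x k" "?x k < s" for k using s by (auto simp: field_simps)
    show "?x k \<in> {0..1}" for k using x[of k] s(2) by simp
    have "(\<lambda>k. s / real (k + 2)) \<longlonglongrightarrow> 0"
      using LIMSEQ_ignore_initial_segment[OF lim_const_over_n[of s], of 2] by simp
    from tendsto_diff[OF tendsto_const this, of s] show "?x \<longlonglongrightarrow> s" by simp
    show "Re v \<le> 0" if "v \<in> eigenvalues (A (?x k))" for k v
    proof (rule ccontr)
      assume "\<not> Re v \<le> 0"
      then have "?x k \<in> N"
        unfolding N_def using that x[of k] s(2) by (intro CollectI conjI bexI[of _ v]) auto
      then show False using below[OF x] by simp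
    qed
  qed
  have below_1: "t \<notin> N" if "0 \<le> t" "t < 1" for t
  proof
    assume "t \<in> N"
    then obtain s where s: "s \<in> N" "\<And>r. r \<in> N \<Longrightarrow> s \<le> r"
      using \<open>compact N\<close> compact_attains_inf[of N] by blast
    then have "s < 1" using \<open>t \<in> N\<close> that by force
    have "s \<noteq> 0" using start s(1) by (force simp: hurwitz_def N_def)
    then have "s > 0" using s(1) by (auto simp: N_def)
    obtain w where w: "w \<in> eigenvalues (A s)" "Re w \<ge> 0" using s(1) by (auto simp: N_def)
    have "Re w \<le> 0" using left_limit[of s w] s(2) \<open>s > 0\<close> \<open>s < 1\<close> w(1) by force
    then show False using no_imag[OF \<open>s > 0\<close> \<open>s < 1\<close> w(1)] w(2) by simp
  qed
  show ?thesis using left_limit[of 1 z] below_1 z by simp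
qed

section \<open>Dissipation along the segment of tuples\<close>

lemma norm_le_spec_norm:
  fixes X :: "real^'n^'m"
  shows "norm (X *v x) \<le> spec_norm X * norm x"
  unfolding spec_norm_def by (rule onorm) (rule matrix_vector_mul_bounded_linear)

lemma transpose_add: "transpose (X + Y) = transpose X + transpose (Y :: real^'n^'m)"
  by (simp add: transpose_def vec_eq_iff)

lemma matrix_vector_mult_uminus: "(- X) *v x = - (X *v (x :: real^'n))"
  by (simp add: vec_eq_iff matrix_vector_mult_def sum_negf)

lemma inner_transpose_right:
  fixes X :: "real^'n^'m"
  shows "x \<bullet> (transpose X *v y) = (X *v x) \<bullet> y"
  by (simp add: inner_matrix_transpose[of x "transpose X"] del: transpose_matrix_vector)

text \<open>
  A quadratic form sees only the symmetric part of its matrix, so \<open>P\<close> enters all estimates through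
  \<open>P + P\<^sup>T\<close>.
\<close>

lemma lyapunov_form:
  fixes X P :: "real^'n^'n"
  shows "x \<bullet> ((transpose X ** P + P ** X) *v x) = (X *v x) \<bullet> ((P + transpose P) *v x)"
proof -
  have "x \<bullet> ((transpose X ** P) *v x) = (X *v x) \<bullet> (P *v x)"
    by (simp only: matrix_vector_mul_assoc[symmetric] inner_transpose_right)
  moreover have "x \<bullet> ((P ** X) *v x) = (X *v x) \<bullet> (transpose P *v x)"
    by (simp only: matrix_vector_mul_assoc[symmetric] inner_matrix_transpose[of x P]) (rule inner_commute)
  ultimately show ?thesis
    by (simp add: matrix_vector_mult_add_rdistrib inner_add_right)
qed

lemma sandwich_form:
  fixes R :: "real^'m^'m" and C D :: "real^'n^'m"
  shows "x \<bullet> ((transpose C ** R ** D) *v x) = (C *v x) \<bullet> (R *v (D *v x))"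
  by (simp only: matrix_vector_mul_assoc[symmetric] inner_transpose_right)

text \<open>
  Along the segment from the known tuple to the new one, the Lyapunov expression is a polynomial of
  degree two in \<open>t\<close>. Its constant term vanishes by the Lyapunov equation, its linear coefficient is the
  left-hand side of the matrix inequality without the term \<open>\<alpha> I\<close>, hence at most \<open>- \<alpha> |x|\<^sup>2\<close>, and its quadratic
  coefficient is at most \<open>\<alpha> |x|\<^sup>2\<close> by the norm bounds. The dissipation is therefore strict for
  \<open>0 < t < 1\<close> and may be lost only at the end points.
\<close>

lemma dissipation_along_homotopy:
  fixes F0 F1 Ps dP W Lam :: "real^'n^'n" and Bc :: "real^'m^'n"
    and Cs dC :: "real^'n^'m" and R :: "real^'m^'m"
  assumes R: "0 \<preceq>\<^sub>L R" and dP: "transpose dP = dP"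
    and F1: "F1 = - (Bc ** dC) + \<delta> *\<^sub>R Lam"
    and lyap: "transpose F0 ** Ps + Ps ** F0 = - (W + transpose Cs ** R ** Cs)"
    and lmi: "(transpose F0 ** (Ps + dP) + (Ps + dP) ** F0) + (transpose F1 ** Ps + Ps ** F1)
      + (W + transpose Cs ** R ** Cs + transpose dC ** R ** Cs + transpose Cs ** R ** dC)
      + \<alpha> *\<^sub>R mat 1 \<preceq>\<^sub>L 0"
    and \<delta>: "\<bar>\<delta>\<bar> \<le> \<zeta>1" and \<zeta>2: "spec_norm dP \<le> \<zeta>2"
    and \<alpha>: "\<alpha> \<ge> 2 * \<zeta>1 * spec_norm (transpose Lam ** dP) + 2 * \<zeta>2 * spec_norm (Bc ** dC)
                 + (spec_norm (psd_sqrt R ** dC))\<^sup>2"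
    and t: "0 \<le> t" "t \<le> 1"
  shows "((F0 + t *\<^sub>R F1) *v x) \<bullet> ((Ps + transpose Ps + (2 * t) *\<^sub>R dP) *v x) + x \<bullet> (W *v x)
      + ((Cs + t *\<^sub>R dC) *v x) \<bullet> (R *v ((Cs + t *\<^sub>R dC) *v x)) \<le> - (t * (1 - t) * \<alpha> * (x \<bullet> x))"
proof -
  define f0 f1 p0 p1 c d where "f0 = F0 *v x" and "f1 = F1 *v x" and "p0 = (Ps + transpose Ps) *v x"
    and "p1 = 2 *\<^sub>R (dP *v x)" and "c = Cs *v x" and "d = dC *v x"
  note defs = f0_def f1_def p0_def p1_def c_def d_def
  have Rsym: "c \<bullet> (R *v d) = d \<bullet> (R *v c)"
    using R by (simp add: loewner_le_def inner_matrix_transpose[of c] inner_commute)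
  have equality: "f0 \<bullet> p0 + x \<bullet> (W *v x) + c \<bullet> (R *v c) = 0"
  proof -
    have "x \<bullet> ((transpose F0 ** Ps + Ps ** F0) *v x) = - (x \<bullet> (W *v x) + c \<bullet> (R *v c))"
      unfolding lyap sandwich_form[symmetric] c_def
      by (simp only: matrix_vector_mult_uminus matrix_vector_mult_add_rdistrib inner_add_right inner_minus_right)
    then show ?thesis by (simp add: lyapunov_form defs)
  qed
  have linear: "f0 \<bullet> p1 + f1 \<bullet> p0 + 2 * (d \<bullet> (R *v c)) + \<alpha> * (x \<bullet> x) \<le> 0"
  proof -
    define L0 L1 where "L0 = transpose F0 ** (Ps + dP) + (Ps + dP) ** F0"
      and "L1 = transpose F1 ** Ps + Ps ** F1"
    have "Ps + dP + transpose (Ps + dP) = Ps + transpose Ps + 2 *\<^sub>R dP"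
      by (simp add: transpose_add dP scaleR_2)
    then have "x \<bullet> (L0 *v x) = f0 \<bullet> (p0 + p1)"
      unfolding lyapunov_form L0_def
      by (simp only: defs matrix_vector_mult_add_rdistrib scaleR_matrix_vector_assoc)
    moreover have "x \<bullet> (L1 *v x) = f1 \<bullet> p0"
      unfolding lyapunov_form L1_def defs ..
    moreover have "x \<bullet> ((L0 + L1
      + (W + transpose Cs ** R ** Cs + transpose dC ** R ** Cs + transpose Cs ** R ** dC)
      + \<alpha> *\<^sub>R mat 1) *v x) \<le> 0"
      using lmi[folded L0_def L1_def] unfolding loewner_le_def
      by (simp only: diff_0 matrix_vector_mult_uminus inner_minus_right) simp
    ultimately have "f0 \<bullet> (p0 + p1) + f1 \<bullet> p0 + (x \<bullet> (W *v x) + c \<bullet> (R *v c) + d \<bullet> (R *v c) + c \<bullet> (R *v d))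
        + \<alpha> * (x \<bullet> x) \<le> 0"
      by (simp only: matrix_vector_mult_add_rdistrib inner_add_right sandwich_form c_def d_def
        scaleR_matrix_vector_assoc[symmetric] matrix_vector_mul_lid inner_scaleR_right)
    then show ?thesis using equality Rsym by (simp add: inner_add_right)
  qed
  have quadratic: "f1 \<bullet> p1 + d \<bullet> (R *v d) \<le> \<alpha> * (x \<bullet> x)"
  proof -
    have n: "norm x * norm x = x \<bullet> x" by (simp add: dot_square_norm power2_eq_square)
    have 1: "\<bar>(Lam *v x) \<bullet> (dP *v x)\<bar> \<le> spec_norm (transpose Lam ** dP) * (x \<bullet> x)"
    proof -
      have "(Lam *v x) \<bullet> (dP *v x) = x \<bullet> ((transpose Lam ** dP) *v x)"
        by (simp only: matrix_vector_mul_assoc[symmetric] inner_transpose_right)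
      then have "\<bar>(Lam *v x) \<bullet> (dP *v x)\<bar> \<le> norm x * norm ((transpose Lam ** dP) *v x)"
        by (simp add: Cauchy_Schwarz_ineq2)
      also have "\<dots> \<le> norm x * (spec_norm (transpose Lam ** dP) * norm x)"
        by (intro mult_left_mono norm_le_spec_norm) simp
      finally show ?thesis unfolding n[symmetric] by (simp add: mult_ac)
    qed
    have "\<bar>\<delta> * ((Lam *v x) \<bullet> (dP *v x))\<bar> \<le> \<zeta>1 * (spec_norm (transpose Lam ** dP) * (x \<bullet> x))"
      unfolding abs_mult using 1 \<delta> by (intro mult_mono) auto
    moreover have "\<bar>((Bc ** dC) *v x) \<bullet> (dP *v x)\<bar> \<le> \<zeta>2 * (spec_norm (Bc ** dC) * (x \<bullet> x))"
    proof -
      have "norm (dP *v x) \<le> \<zeta>2 * norm x"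
        using norm_le_spec_norm[of dP x] mult_right_mono[OF \<zeta>2 norm_ge_zero[of x]] by linarith
      then have "norm ((Bc ** dC) *v x) * norm (dP *v x) \<le> (spec_norm (Bc ** dC) * norm x) * (\<zeta>2 * norm x)"
        by (intro mult_mono norm_le_spec_norm order.trans[OF norm_ge_zero norm_le_spec_norm]) auto
      with Cauchy_Schwarz_ineq2[of "(Bc ** dC) *v x" "dP *v x"] show ?thesis
        unfolding n[symmetric] by (simp add: mult_ac)
    qed
    moreover have "d \<bullet> (R *v d) \<le> (spec_norm (psd_sqrt R ** dC))\<^sup>2 * (x \<bullet> x)"
    proof -
      have "d \<bullet> (R *v d) = (norm ((psd_sqrt R ** dC) *v x))\<^sup>2"
        by (simp only: inner_psd_sqrt[OF R] d_def) (simp only: matrix_vector_mul_assoc)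
      also have "\<dots> \<le> (spec_norm (psd_sqrt R ** dC) * norm x)\<^sup>2"
        by (intro power_mono norm_le_spec_norm) simp
      finally show ?thesis by (simp add: power_mult_distrib dot_square_norm)
    qed
    moreover have "f1 \<bullet> p1 = 2 * (\<delta> * ((Lam *v x) \<bullet> (dP *v x))) - 2 * (((Bc ** dC) *v x) \<bullet> (dP *v x))"
      by (simp add: defs F1 matrix_vector_mult_diff_rdistrib inner_diff_left right_diff_distrib
        scaleR_matrix_vector_assoc[symmetric])
    moreover have "(2 * \<zeta>1 * spec_norm (transpose Lam ** dP) + 2 * \<zeta>2 * spec_norm (Bc ** dC)
                 + (spec_norm (psd_sqrt R ** dC))\<^sup>2) * (x \<bullet> x) \<le> \<alpha> * (x \<bullet> x)"
      using \<alpha> by (rule mult_right_mono) simp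
    ultimately show ?thesis by (simp add: distrib_right abs_le_iff)
  qed
  have "((F0 + t *\<^sub>R F1) *v x) \<bullet> ((Ps + transpose Ps + (2 * t) *\<^sub>R dP) *v x) + x \<bullet> (W *v x)
      + ((Cs + t *\<^sub>R dC) *v x) \<bullet> (R *v ((Cs + t *\<^sub>R dC) *v x))
    = (f0 + t *\<^sub>R f1) \<bullet> (p0 + t *\<^sub>R p1) + x \<bullet> (W *v x) + (c + t *\<^sub>R d) \<bullet> (R *v (c + t *\<^sub>R d))"
    by (simp add: defs matrix_vector_mult_add_rdistrib scaleR_matrix_vector_assoc[symmetric] mult.commute)
  also have "\<dots> = (f0 \<bullet> p0 + x \<bullet> (W *v x) + c \<bullet> (R *v c))
      + t * (f0 \<bullet> p1 + f1 \<bullet> p0 + 2 * (d \<bullet> (R *v c))) + t\<^sup>2 * (f1 \<bullet> p1 + d \<bullet> (R *v d))"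
    by (simp add: Rsym matrix_vector_right_distrib matrix_vector_mult_scaleR inner_add_left inner_add_right
      power2_eq_square algebra_simps)
  also have "\<dots> \<le> 0 + t * (- (\<alpha> * (x \<bullet> x))) + t\<^sup>2 * (\<alpha> * (x \<bullet> x))"
    using equality linear quadratic t by (intro add_mono mult_left_mono) auto
  finally show ?thesis by (simp add: power2_eq_square algebra_simps)
qed

section \<open>Block structure and stability\<close>

lemma matrix_mult_add_left:
  fixes X Y :: "real^'n^'m" and Z :: "real^'p^'n"
  shows "(X + Y) ** Z = X ** Z + Y ** Z"
  by (simp add: matrix_matrix_mult_def vec_eq_iff sum.distrib distrib_right)

lemma sum_grid_index:
  "(\<Sum>q\<in>UNIV. f q) = (\<Sum>j\<in>(UNIV :: 'g::finite set). \<Sum>b\<in>(UNIV :: 'n::finite set). f (j, b))"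
  by (simp add: sum.cartesian_product UNIV_Times_UNIV[symmetric] del: UNIV_Times_UNIV)

lemma transpose_M_mat_nth:
  fixes x :: "real^('g::{finite,linorder} \<times> 'n::finite)"
  assumes l: "\<And>i :: 'g. pos i = CARD('g) \<longleftrightarrow> i = l"
  shows "(transpose M_mat *v x) $ b = x $ (l, b)"
proof -
  have "(transpose M_mat *v x) $ b
      = (\<Sum>j\<in>UNIV. \<Sum>b'\<in>UNIV. (if j = l \<and> b' = b then 1 else 0) * x $ (j, b'))"
    by (simp only: matrix_vector_mult_def transpose_def M_mat_def vec_lambda_beta sum_grid_index l fst_conv snd_conv)
  also have "\<dots> = (\<Sum>j\<in>UNIV. if j = l then x $ (j, b) else 0)"
    by (intro sum.cong refl) (simp add: if_distrib[of "\<lambda>c. c * _"] cong: if_cong)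
  finally show ?thesis by simp
qed

lemma last_block_nth:
  fixes x :: "real^('g::{finite,linorder} \<times> 'n::finite)"
  shows "(last_block A *v x) $ (i, b) = (if pos i = CARD('g) then (A *v (transpose M_mat *v x)) $ b else 0)"
proof -
  obtain l :: 'g where l: "\<And>i. pos i = CARD('g) \<longleftrightarrow> i = l" using last_node[where 'g = 'g] by blast
  have "(last_block A *v x) $ (i, b)
      = (\<Sum>j\<in>UNIV. \<Sum>b'\<in>UNIV. (if i = l \<and> j = l then A $ b $ b' else 0) * x $ (j, b'))"
    by (simp only: matrix_vector_mult_def last_block_def vec_lambda_beta sum_grid_index l fst_conv snd_conv)
  also have "\<dots> = (\<Sum>j\<in>UNIV. if j = l then (if i = l then \<Sum>b'\<in>UNIV. A $ b $ b' * x $ (l, b') else 0) else 0)"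
    by (intro sum.cong refl) auto
  also have "\<dots> = (if i = l then (A *v (transpose M_mat *v x)) $ b else 0)"
    by (simp add: matrix_vector_mult_def[of A] transpose_M_mat_nth[OF l] del: transpose_matrix_vector)
  finally show ?thesis by (simp only: l)
qed

lemma Lambda_mat_nth:
  fixes x :: "real^('g::{finite,linorder} \<times> 'n::finite)"
  shows "(Lambda_mat 1 *v x) $ (i, b)
    = (if pos i < CARD('g) then \<Sum>j\<in>UNIV. deriv (lagrange 1 j) (grid 1 i) * x $ (j, b) else 0)"
proof -
  have "(Lambda_mat 1 *v x) $ (i, b) = (\<Sum>j\<in>UNIV. \<Sum>b'\<in>UNIV.
      (if pos i < CARD('g) \<and> b = b' then deriv (lagrange 1 j) (grid 1 i) else 0) * x $ (j, b'))"
    by (simp only: matrix_vector_mult_def Lambda_mat_def vec_lambda_beta sum_grid_index fst_conv snd_conv mult_1)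
  also have "\<dots> = (\<Sum>j\<in>UNIV. if pos i < CARD('g) then deriv (lagrange 1 j) (grid 1 i) * x $ (j, b) else 0)"
    by (intro sum.cong refl) (simp add: if_distrib[of "\<lambda>c. c * _"] cong: if_cong)
  finally show ?thesis by simp
qed

text \<open>
  The last block of an eigenvector of the open-loop matrix is an eigenvector of \<open>A\<close>, so an imaginary
  mode that the output \<open>C\<close> does not see has last block zero by detectability. What remains is an
  eigenvector of the differentiation matrix with zero last entry, in each of the \<open>n\<close> coordinates.
\<close>

lemma uncontrolled_imaginary_mode_vanishes:
  fixes A :: "real^'n^'n" and C :: "real^'n^'p" and a b :: "real^('g::{finite,linorder} \<times> 'n::finite)"
  assumes N: "CARD('g) \<ge> 2" and det: "detectable A C" and \<omega>: "\<omega> > 0"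
    and a: "(\<omega> *\<^sub>R Lambda_mat 1 + last_block A) *v a = - (y *\<^sub>R b)" "C *v (transpose M_mat *v a) = 0"
    and b: "(\<omega> *\<^sub>R Lambda_mat 1 + last_block A) *v b = y *\<^sub>R a" "C *v (transpose M_mat *v b) = 0"
  shows "a = 0 \<and> b = 0"
proof -
  obtain l :: 'g where l: "\<And>i. pos i = CARD('g) \<longleftrightarrow> i = l" using last_node[where 'g = 'g] by blast
  define aN bN :: "real^'n" where "aN = transpose M_mat *v a" and "bN = transpose M_mat *v b"
  have nth: "\<omega> * (Lambda_mat 1 *v x) $ (i, k) + (last_block A *v x) $ (i, k)
      = ((\<omega> *\<^sub>R Lambda_mat 1 + last_block A) *v x) $ (i, k)" for x i k
    by (simp add: matrix_vector_mult_add_rdistrib scaleR_matrix_vector_assoc[symmetric])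
  have "A *v aN = - (y *\<^sub>R bN)" "A *v bN = y *\<^sub>R aN"
    using nth[of a l] nth[of b l] l[of l] unfolding a(1) b(1)
    by (simp_all add: vec_eq_iff Lambda_mat_nth last_block_nth aN_def bN_def transpose_M_mat_nth[OF l]
      del: transpose_matrix_vector)
  obtain L where L: "hurwitz (A - L ** C)" using det by (auto simp: detectable_def)
  have "(A - L ** C) *v aN = - (y *\<^sub>R bN)" "(A - L ** C) *v bN = y *\<^sub>R aN"
    using a(2) b(2) \<open>A *v aN = _\<close> \<open>A *v bN = _\<close>
    by (simp_all add: matrix_vector_mult_diff_rdistrib matrix_vector_mul_assoc[symmetric] aN_def bN_def
      del: transpose_matrix_vector)
  then have "Complex 0 y \<in> eigenvalues (A - L ** C)" if "aN \<noteq> 0 \<or> bN \<noteq> 0"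
    using that by (auto simp: eigenvalues_real_pair_iff)
  then have N0: "aN = 0" "bN = 0" using L by (force simp: hurwitz_def)+
  have "Complex (a $ (i, k)) (b $ (i, k)) = 0" for i k
  proof (rule differentiation_matrix_no_imaginary_eigenvalue[of "Complex 0 (y / \<omega>)" "\<lambda>i. Complex (a $ (i, k)) (b $ (i, k))"])
    show "Complex (a $ (i, k)) (b $ (i, k)) = 0" if "pos i = CARD('g)" for i
      using that N0 transpose_M_mat_nth[OF l, of a k] transpose_M_mat_nth[OF l, of b k]
      by (simp add: l aN_def bN_def complex_eq_iff del: transpose_matrix_vector)
    show "(\<Sum>j\<in>UNIV. of_real (deriv (lagrange 1 j) (grid 1 i)) * Complex (a $ (j, k)) (b $ (j, k)))
        = Complex 0 (y / \<omega>) * Complex (a $ (i, k)) (b $ (i, k))" if i: "pos i < CARD('g)" for i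
    proof -
      have "\<omega> * (\<Sum>j\<in>UNIV. deriv (lagrange 1 j) (grid 1 i) * a $ (j, k)) = - (y * b $ (i, k))"
        "\<omega> * (\<Sum>j\<in>UNIV. deriv (lagrange 1 j) (grid 1 i) * b $ (j, k)) = y * a $ (i, k)"
        using nth[of a i k] nth[of b i k] i unfolding a(1) b(1) by (simp_all add: Lambda_mat_nth last_block_nth)
      then have "(\<Sum>j\<in>UNIV. deriv (lagrange 1 j) (grid 1 i) * a $ (j, k)) = - (y / \<omega> * b $ (i, k))"
        "(\<Sum>j\<in>UNIV. deriv (lagrange 1 j) (grid 1 i) * b $ (j, k)) = y / \<omega> * a $ (i, k)"
        using \<omega> by (simp_all add: field_simps)
      then show ?thesis by (simp add: complex_eq_iff)
    qed
  qed (use N in simp_all)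
  then show ?thesis by (auto simp: vec_eq_iff complex_eq_iff)
qed

lemma A_cl_decomposition:
  assumes "\<omega> > 0"
  shows "(A_cl A B D K (1 / \<omega>) c :: real^('g::{finite,linorder} \<times> 'n::finite)^('g \<times> 'n))
    = \<omega> *\<^sub>R Lambda_mat 1 + last_block A
      - B_cal B ** ((K \<circ>\<^sub>H D) ** transpose (Nd_mat 1 c) + (K \<circ>\<^sub>H pattern_o D) ** transpose No_mat)"
  using assms
  by (simp add: A_cl_def A_tilde_def Lambda_mat_indep[of "1 / \<omega>"] Nd_mat_indep[of "1 / \<omega>"] matrix_add_ldistrib matrix_mul_assoc)

lemma Q_tilde_form:
  assumes "0 \<preceq>\<^sub>L Q"
  shows "x \<bullet> (Q_tilde Q *v x) = (norm (psd_sqrt Q *v (transpose M_mat *v x)))\<^sup>2"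
proof -
  have "x \<bullet> (Q_tilde Q *v x) = (transpose M_mat *v x) \<bullet> (Q *v (transpose M_mat *v x))"
    by (simp only: Q_tilde_def matrix_vector_mul_assoc[symmetric] inner_matrix_transpose[of x M_mat])
  then show ?thesis by (simp only: inner_psd_sqrt[OF assms])
qed

text \<open>
  On an eigenvector with imaginary eigenvalue the derivative of every quadratic form along the flow
  averages to zero.
\<close>

lemma skew_pair_cancels:
  fixes X S :: "real^'n^'n"
  assumes "X *v a = - (y *\<^sub>R b)" "X *v b = y *\<^sub>R a" "transpose S = S"
  shows "(X *v a) \<bullet> (S *v a) + (X *v b) \<bullet> (S *v b) = 0"
  using inner_matrix_transpose[of a S b] assms by (simp add: inner_commute)

theorem theorem2:
  fixes A :: "real^'n^'n" and B :: "real^'m^'n"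
    and Q :: "real^'n^'n" and R :: "real^'m^'m"
    and nparts :: nat and U :: "nat \<Rightarrow> 'm set" and X :: "nat \<Rightarrow> 'n set"
    and Id_pat Io_pat :: "real^'n^'m"
    and Ks \<Delta>K K Kds Kos \<Delta>Kd \<Delta>Ko :: "real^'n^'m"
    and \<omega>s \<Delta>\<omega> \<omega> cs \<zeta>1 \<zeta>2 \<alpha> :: real
    and Ps \<Delta>P P Acls Lam A1 \<phi>0 \<phi>1 \<psi>0 Qt
      :: "real^('g::{finite,linorder} \<times> 'n::finite)^('g \<times> 'n)"
    and No Nd :: "real^'n^('g \<times> 'n)"
    and Bc :: "real^'m^('g \<times> 'n)"
    and Cs \<Delta>C :: "real^('g \<times> 'n)^'m"
  assumes N: "CARD('g) \<ge> 2"
    and Q: "0 \<preceq>\<^sub>L Q" and R: "0 \<prec>\<^sub>L R"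
    and stab: "stabilizable A B" and det: "detectable A (psd_sqrt Q)"
    and U: "indexed_partition nparts U" and X: "indexed_partition nparts X"
    and Idp: "Id_pat = pattern_d nparts U X" and Iop: "Io_pat = pattern_o Id_pat"
    and known: "(Ks, 1 / \<omega>s, cs) \<in> stabilizing_tuples TYPE('g) A B Id_pat"
    and Acls: "Acls = A_cl A B Id_pat Ks (1 / \<omega>s) cs"
    and Lam: "Lam = Lambda_mat (1 / \<omega>s)"
    and No: "No = No_mat" and Nd: "Nd = Nd_mat (1 / \<omega>s) cs"
    and Bc: "Bc = B_cal B" and Qt: "Qt = Q_tilde Q"
    and Kds: "Kds = Ks \<circ>\<^sub>H Id_pat" and Kos: "Kos = Ks \<circ>\<^sub>H Io_pat"
    and Cs: "Cs = Kds ** transpose Nd + Kos ** transpose No"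
    and lyap: "transpose Acls ** Ps + Ps ** Acls = - (Qt + transpose Cs ** R ** Cs)"
    and \<omega>: "\<omega> = \<omega>s + \<Delta>\<omega>" "\<omega> > 0"
    and K: "K = Ks + \<Delta>K"
    and P: "P = Ps + \<Delta>P" "transpose \<Delta>P = \<Delta>P"
    and \<alpha>: "\<alpha> > 0"
    and \<Delta>Kd: "\<Delta>Kd = \<Delta>K \<circ>\<^sub>H Id_pat" and \<Delta>Ko: "\<Delta>Ko = \<Delta>K \<circ>\<^sub>H Io_pat"
    and \<Delta>C: "\<Delta>C = \<Delta>Kd ** transpose Nd + \<Delta>Ko ** transpose No"
    and A1: "A1 = - (Bc ** \<Delta>C) + \<Delta>\<omega> *\<^sub>R Lam"
    and \<phi>0: "\<phi>0 = transpose Acls ** P + P ** Acls"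
    and \<phi>1: "\<phi>1 = transpose A1 ** Ps + Ps ** A1"
    and \<psi>0: "\<psi>0 = Qt + transpose Cs ** R ** Cs
                 + transpose \<Delta>C ** R ** Cs + transpose Cs ** R ** \<Delta>C"
    and lmi: "\<phi>0 + \<phi>1 + \<psi>0 + \<alpha> *\<^sub>R mat 1 \<preceq>\<^sub>L 0"
    and bound_\<omega>: "\<bar>\<Delta>\<omega>\<bar> \<le> \<zeta>1"
    and bound_P: "spec_norm \<Delta>P \<le> \<zeta>2"
    and bound_\<alpha>: "\<alpha> \<ge> 2 * \<zeta>1 * spec_norm (transpose Lam ** \<Delta>P)
                     + 2 * \<zeta>2 * spec_norm (Bc ** \<Delta>C)
                     + (spec_norm (psd_sqrt R ** \<Delta>C))\<^sup>2"
  shows "(K, 1 / \<omega>, cs) \<in> stabilizing_tuples TYPE('g) A B Id_pat"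
proof -
  have \<omega>s: "\<omega>s > 0" and cs: "0 \<le> cs" "cs \<le> 1" and start: "hurwitz Acls"
    using known by (auto simp: stabilizing_tuples_def Acls)
  have Lam1: "Lam = Lambda_mat 1" and Nd1: "Nd = Nd_mat 1 cs"
    using \<omega>s by (simp_all add: Lam Nd Lambda_mat_indep[of "1 / \<omega>s"] Nd_mat_indep[of "1 / \<omega>s"])
  have Rle: "0 \<preceq>\<^sub>L R"
    unfolding loewner_le_def
  proof (intro conjI allI)
    show "0 \<le> x \<bullet> ((R - 0) *v x)" for x
      using R by (cases "x = 0") (auto simp: loewner_less_def less_imp_le)
  qed (use R in \<open>auto simp: loewner_less_def\<close>)
  define At where "At = (\<lambda>t. Acls + t *\<^sub>R A1)"
  define Ct where "Ct = (\<lambda>t. Cs + t *\<^sub>R \<Delta>C)"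
  define St where "St = (\<lambda>t. Ps + transpose Ps + (2 * t) *\<^sub>R \<Delta>P)"
  have sym: "transpose (St t) = St t" for t
    using P(2) by (simp add: St_def transpose_def vec_eq_iff)

  have dissipation: "(At t *v x) \<bullet> (St t *v x) + x \<bullet> (Qt *v x) + (Ct t *v x) \<bullet> (R *v (Ct t *v x))
      \<le> - (t * (1 - t) * \<alpha> * (x \<bullet> x))" if "0 \<le> t" "t \<le> 1" for t x
    unfolding At_def Ct_def St_def
    by (rule dissipation_along_homotopy[OF Rle P(2) A1 lyap lmi[unfolded \<phi>0 \<phi>1 \<psi>0 P(1)] bound_\<omega> bound_P bound_\<alpha> that])

  \<comment> \<open>The Lyapunov derivative of an imaginary pair drops out, so the strict term and the cost of the pair sum to at most zero.\<close>
  have pair: "0 \<le> - (t * (1 - t) * \<alpha> * (a \<bullet> a + b \<bullet> b)) - (a \<bullet> (Qt *v a) + b \<bullet> (Qt *v b))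
      - ((Ct t *v a) \<bullet> (R *v (Ct t *v a)) + (Ct t *v b) \<bullet> (R *v (Ct t *v b)))"
    if "At t *v a = - (y *\<^sub>R b)" "At t *v b = y *\<^sub>R a" "0 \<le> t" "t \<le> 1" for t y a b
    using skew_pair_cancels[OF that(1,2) sym[of t]] dissipation[OF that(3,4), of a] dissipation[OF that(3,4), of b]
    unfolding distrib_left by linarith
  have Q_nonneg: "0 \<le> x \<bullet> (Qt *v x)" for x by (simp add: Qt Q_tilde_form[OF Q])
  have R_nonneg: "0 \<le> x \<bullet> (R *v x)" for x using Rle by (simp add: loewner_le_def)

  have final: "A_cl A B Id_pat K (1 / \<omega>) cs = At 1"
    and final': "At 1 = \<omega> *\<^sub>R Lambda_mat 1 + last_block A - Bc ** Ct 1"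
  proof -
    have hadamard: "K \<circ>\<^sub>H D = Ks \<circ>\<^sub>H D + \<Delta>K \<circ>\<^sub>H D" for D
      by (simp add: K hadamard_def vec_eq_iff distrib_right)
    have Acls': "Acls = \<omega>s *\<^sub>R Lambda_mat 1 + last_block A - Bc ** Cs"
      using A_cl_decomposition[OF \<omega>s] by (simp add: Acls Bc Cs Kds Kos Iop Nd1 No)
    then show 1: "At 1 = \<omega> *\<^sub>R Lambda_mat 1 + last_block A - Bc ** Ct 1"
      by (simp add: At_def Ct_def A1 Lam1 \<omega>(1) scaleR_add_left matrix_add_ldistrib)
    have "(K \<circ>\<^sub>H Id_pat) ** transpose (Nd_mat 1 cs) + (K \<circ>\<^sub>H pattern_o Id_pat) ** transpose No_mat = Ct 1"
      by (simp add: Ct_def Cs \<Delta>C \<Delta>Kd \<Delta>Ko Kds Kos Iop Nd1 No hadamard matrix_mult_add_left)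
    then show "A_cl A B Id_pat K (1 / \<omega>) cs = At 1"
      unfolding 1 A_cl_decomposition[OF \<omega>(2)] by (simp add: Bc)
  qed

  have "Re z < 0" if z: "z \<in> eigenvalues (At 1)" for z
  proof -
    have "Re z \<le> 0"
    proof (rule hurwitz_homotopy[of At, OF _ _ _ z])
      show "continuous_on {0..1} At" unfolding At_def by (intro continuous_intros)
      show "hurwitz (At 0)" using start by (simp add: At_def)
      fix t w assume t: "0 < t" "t < 1" and w: "w \<in> eigenvalues (At t)"
      show "Re w \<noteq> 0"
      proof
        assume "Re w = 0"
        then obtain a b where ab: "a \<noteq> 0 \<or> b \<noteq> 0" "At t *v a = - (Im w *\<^sub>R b)" "At t *v b = Im w *\<^sub>R a"
          using w by (auto simp: eigenvalues_real_pair_iff)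
        have "0 < t * (1 - t) * \<alpha> * (a \<bullet> a + b \<bullet> b)"
          using t \<alpha> ab(1) by (intro mult_pos_pos) (auto intro: add_pos_nonneg add_nonneg_pos)
        then show False
          using pair[OF ab(2,3)] t Q_nonneg[of a] Q_nonneg[of b] R_nonneg[of "Ct t *v a"] R_nonneg[of "Ct t *v b"]
          by simp
      qed
    qed
    moreover have "Re z \<noteq> 0"
    proof
      assume "Re z = 0"
      then obtain a b where ab: "a \<noteq> 0 \<or> b \<noteq> 0" "At 1 *v a = - (Im z *\<^sub>R b)" "At 1 *v b = Im z *\<^sub>R a"
        using z by (auto simp: eigenvalues_real_pair_iff)
      \<comment> \<open>At \<open>t = 1\<close> the dissipation carries no strict term, but every part of the cost has to vanish.\<close>
      have zero: "a \<bullet> (Qt *v a) = 0" "b \<bullet> (Qt *v b) = 0"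
        "(Ct 1 *v a) \<bullet> (R *v (Ct 1 *v a)) = 0" "(Ct 1 *v b) \<bullet> (R *v (Ct 1 *v b)) = 0"
        using pair[OF ab(2,3)] Q_nonneg[of a] Q_nonneg[of b] R_nonneg[of "Ct 1 *v a"] R_nonneg[of "Ct 1 *v b"]
        by simp_all
      have C0: "Ct 1 *v a = 0" "Ct 1 *v b = 0"
        using zero(3,4) R by (auto simp: loewner_less_def dest: less_imp_neq)
      have "a = 0 \<and> b = 0"
      proof (rule uncontrolled_imaginary_mode_vanishes[OF N det \<omega>(2)])
        show "(\<omega> *\<^sub>R Lambda_mat 1 + last_block A) *v a = - (Im z *\<^sub>R b)"
          "(\<omega> *\<^sub>R Lambda_mat 1 + last_block A) *v b = Im z *\<^sub>R a"
          using ab(2,3) C0 unfolding final'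
          by (simp_all add: matrix_vector_mult_diff_rdistrib matrix_vector_mul_assoc[symmetric])
        show "psd_sqrt Q *v (transpose M_mat *v a) = 0" "psd_sqrt Q *v (transpose M_mat *v b) = 0"
          using zero(1,2) by (simp_all add: Qt Q_tilde_form[OF Q])
      qed
      then show False using ab(1) by simp
    qed
    ultimately show ?thesis by simp
  qed
  then have "hurwitz (A_cl A B Id_pat K (1 / \<omega>) cs :: real^('g \<times> 'n)^('g \<times> 'n))"
    unfolding final hurwitz_def by blast
  then show ?thesis using \<omega>(2) cs by (simp add: stabilizing_tuples_def)
qed

end
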